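(* Let $X$ and $Y$ be real Banach spaces such that at least one of $X$, $Y$ has the metric approximation property. If the norm of the projective tensor product $X\widehat{\otimes}_\pi Y$ is strongly subdifferentiable, then every bounded linear operator $T:X\longrightarrow Y^*$ is compact. In particular, if in addition $X$ and $Y$ are reflexive and the norm of $X\widehat{\otimes}_\pi Y$ is strongly subdifferentiable, then $X\widehat{\otimes}_\pi Y$ is reflexive.
   Context: All Banach spaces are real. $B_X$ and $S_X$ denote the closed unit ball and unit sphere of $X$, and $X^*$ its topological dual. The projective tensor product $X\widehat{\otimes}_\pi Y$ is the completion of the algebraic tensor product $X\otimes Y$ under the norm $\|z\|_\pi=\inf\{\sum_{i=1}^n\|x_i\|\|y_i\|: z=\sum_{i=1}^n x_i\otimes y_i\}$. Strong subdifferentiability (SSD): the norm of a Banach space $Z$ is strongly subdifferentiable (one also says $Z$ is SSD) if for every $z\in S_Z$ the one-sided limit $\lim_{t\to 0^+}\frac{\|z+th\|-\|z\|}{t}$ exists uniformly for $h\in S_Z$. Metric approximation property (MAP): $X$ has the MAP if there is a net $(S_\alpha)$ of finite-rank bounded operators $X\to X$ with $\|S_\alpha\|\leq 1$ for all $\alpha$ and $S_\alpha(x)\to x$ for all $x\in X$. *)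

theory Defs
  imports "HOL-Analysis.Analysis"
begin

section \<open>The algebraic tensor product\<close>

text \<open>
  A list \<open>[(x\<^sub>1,y\<^sub>1),\<dots>,(x\<^sub>n,y\<^sub>n)]\<close> stands for the formal sum of the \<open>x\<^sub>i \<otimes> y\<^sub>i\<close>, regarded as
  the functional \<open>B \<mapsto> (\<Sum>i. B x\<^sub>i y\<^sub>i)\<close> on the space of all bilinear forms, with no continuity
  required. Two formal sums are the same tensor iff they induce the same functional, so this
  is the usual model of the tensor product inside the algebraic dual of the bilinear forms.
\<close>

definition eval_sum ::
    "('a::real_vector \<Rightarrow> 'b::real_vector \<Rightarrow> real) \<Rightarrow> ('a \<times> 'b) list \<Rightarrow> real"
  where "eval_sum B u = (\<Sum>(x, y)\<leftarrow>u. B x y)"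

quotient_type (overloaded) ('a, 'b) tensor =
    "('a::real_vector \<times> 'b::real_vector) list" /
    "\<lambda>u v. \<forall>B. bilinear B \<longrightarrow> eval_sum B u = eval_sum B v"
  by (rule equivpI) (auto simp: reflp_def symp_def transp_def)

lemma eval_sum_simps [simp]:
  "eval_sum B [] = 0"
  "eval_sum B (p # u) = B (fst p) (snd p) + eval_sum B u"
  "eval_sum B (u @ v) = eval_sum B u + eval_sum B v"
  by (simp_all add: eval_sum_def case_prod_unfold)

lemma eval_sum_scale:
  "bilinear B \<Longrightarrow> eval_sum B (map (\<lambda>(x, y). (c *\<^sub>R x, y)) u) = c * eval_sum B u"
  by (induction u) (auto simp: bilinear_lmul algebra_simps)

instantiation tensor :: (real_vector, real_vector) real_vector
begin

lift_definition zero_tensor :: "('a, 'b) tensor" is "[]" .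

lift_definition plus_tensor :: "('a, 'b) tensor \<Rightarrow> ('a, 'b) tensor \<Rightarrow> ('a, 'b) tensor"
  is "(@)" by simp

lift_definition scaleR_tensor :: "real \<Rightarrow> ('a, 'b) tensor \<Rightarrow> ('a, 'b) tensor"
  is "\<lambda>c. map (\<lambda>(x, y). (c *\<^sub>R x, y))" by (simp add: eval_sum_scale)

definition uminus_tensor :: "('a, 'b) tensor \<Rightarrow> ('a, 'b) tensor"
  where "uminus_tensor z = (-1) *\<^sub>R z"

definition minus_tensor :: "('a, 'b) tensor \<Rightarrow> ('a, 'b) tensor \<Rightarrow> ('a, 'b) tensor"
  where "minus_tensor z w = z + (-1) *\<^sub>R w"

instance
proof
  fix a b c :: "('a, 'b) tensor" and r s :: real
  show "a + b + c = a + (b + c)" by transfer simp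
  show "a + b = b + a" by transfer simp
  show "0 + a = a" by transfer simp
  show "- a + a = 0"
    unfolding uminus_tensor_def
    by (transfer, intro allI impI, subst eval_sum_simps, subst eval_sum_scale) simp_all
  show "a - b = a + - b" unfolding uminus_tensor_def minus_tensor_def ..
  show "r *\<^sub>R (a + b) = r *\<^sub>R a + r *\<^sub>R b" by transfer (auto simp: eval_sum_scale algebra_simps)
  show "(r + s) *\<^sub>R a = r *\<^sub>R a + s *\<^sub>R a"
    by (transfer, intro allI impI, subst eval_sum_simps, (subst eval_sum_scale, assumption)+)
       (simp add: algebra_simps)
  show "r *\<^sub>R s *\<^sub>R a = (r * s) *\<^sub>R a"
    by (transfer, intro allI impI, (subst eval_sum_scale, assumption)+) simp
  show "1 *\<^sub>R a = a"
    by (transfer, intro allI impI, subst eval_sum_scale) simp_all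
qed

end

lift_definition tens :: "'a::real_vector \<Rightarrow> 'b::real_vector \<Rightarrow> ('a, 'b) tensor"
  is "\<lambda>x y. [(x, y)]" .

lemma bilinear_tens: "bilinear tens"
  unfolding bilinear_def
  by (intro conjI allI linearI; transfer;
      simp add: bilinear_ladd bilinear_radd bilinear_lmul bilinear_rmul)

lemma sum_tens_eq_abs: "(\<Sum>(x, y)\<leftarrow>u. tens x y) = abs_tensor u"
proof (induction u)
  case Nil
  show ?case by (simp add: zero_tensor_def)
next
  case (Cons p u)
  then show ?case
    by (cases p) (simp add: tens.abs_eq plus_tensor.abs_eq)
qed

lemma tensor_eq_sum: "\<exists>u. z = (\<Sum>(x, y)\<leftarrow>u. tens x y)"
  by (rule exI[of _ "rep_tensor z"])
     (simp only: sum_tens_eq_abs Quotient_abs_rep[OF Quotient_tensor])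


section \<open>The projective norm\<close>

definition proj_norm :: "('a::real_normed_vector, 'b::real_normed_vector) tensor \<Rightarrow> real"
  where "proj_norm z =
    Inf {(\<Sum>(x, y)\<leftarrow>u. norm x * norm y) | u. z = (\<Sum>(x, y)\<leftarrow>u. tens x y)}"

lemma cost_nonneg: "0 \<le> (\<Sum>(x, y)\<leftarrow>u. norm x * norm y)"
  by (rule sum_list_nonneg) auto

lemma proj_norm_le:
  assumes "z = (\<Sum>(x, y)\<leftarrow>u. tens x y)"
  shows "proj_norm z \<le> (\<Sum>(x, y)\<leftarrow>u. norm x * norm y)"
  unfolding proj_norm_def
  by (rule cInf_lower) (use assms cost_nonneg in \<open>auto intro!: bdd_belowI[of _ 0]\<close>)

lemma proj_norm_nonneg [simp]: "0 \<le> proj_norm z"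
  unfolding proj_norm_def
  by (rule cInf_greatest) (use tensor_eq_sum[of z] cost_nonneg in auto)

lemma proj_norm_approx:
  assumes "e > 0"
  obtains u where "z = (\<Sum>(x, y)\<leftarrow>u. tens x y)"
    and "(\<Sum>(x, y)\<leftarrow>u. norm x * norm y) < proj_norm z + e"
proof -
  let ?S = "{(\<Sum>(x, y)\<leftarrow>u. norm x * norm y) | u. z = (\<Sum>(x, y)\<leftarrow>u. tens x y)}"
  have "?S \<noteq> {}" using tensor_eq_sum[of z] by auto
  moreover have "Inf ?S < proj_norm z + e" using assms by (simp add: proj_norm_def)
  ultimately have "\<exists>c\<in>?S. c < proj_norm z + e"
    by (rule cInf_lessD)
  with that show thesis by blast
qed

lemma proj_norm_0 [simp]: "proj_norm 0 = 0"
  using proj_norm_le[of 0 "[]"] by (intro order_antisym) simp_all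

lemma proj_norm_triangle: "proj_norm (z + w) \<le> proj_norm z + proj_norm w"
proof (rule field_le_epsilon)
  fix e :: real assume "e > 0"
  then have e: "e/2 > 0" by simp
  obtain u where u: "z = (\<Sum>(x, y)\<leftarrow>u. tens x y)"
      "(\<Sum>(x, y)\<leftarrow>u. norm x * norm y) < proj_norm z + e/2"
    using proj_norm_approx[OF e] .
  obtain v where v: "w = (\<Sum>(x, y)\<leftarrow>v. tens x y)"
      "(\<Sum>(x, y)\<leftarrow>v. norm x * norm y) < proj_norm w + e/2"
    using proj_norm_approx[OF e] .
  have "z + w = (\<Sum>(x, y)\<leftarrow>u @ v. tens x y)"
    unfolding u(1) v(1) by simp
  then have "proj_norm (z + w) \<le> (\<Sum>(x, y)\<leftarrow>u @ v. norm x * norm y)"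
    by (rule proj_norm_le)
  then show "proj_norm (z + w) \<le> proj_norm z + proj_norm w + e"
    using u(2) v(2) by simp
qed

lemma proj_norm_scaleR_le: "proj_norm (c *\<^sub>R z) \<le> \<bar>c\<bar> * proj_norm z"
proof (rule field_le_epsilon)
  fix e :: real assume e: "e > 0"
  define d where "d = e / (\<bar>c\<bar> + 1)"
  have d: "d > 0" "\<bar>c\<bar> * d \<le> e" using e by (auto simp: d_def field_simps)
  obtain u where u: "z = (\<Sum>(x, y)\<leftarrow>u. tens x y)"
      "(\<Sum>(x, y)\<leftarrow>u. norm x * norm y) < proj_norm z + d"
    using proj_norm_approx[OF d(1)] .
  let ?v = "map (\<lambda>(x, y). (c *\<^sub>R x, y)) u"
  have "c *\<^sub>R z = (\<Sum>(x, y)\<leftarrow>?v. tens x y)"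
    by (simp only: u(1) sum_tens_eq_abs scaleR_tensor.abs_eq)
  then have "proj_norm (c *\<^sub>R z) \<le> (\<Sum>(x, y)\<leftarrow>?v. norm x * norm y)"
    by (rule proj_norm_le)
  also have "\<dots> = \<bar>c\<bar> * (\<Sum>(x, y)\<leftarrow>u. norm x * norm y)"
    by (induction u) (auto simp: algebra_simps)
  also have "\<dots> \<le> \<bar>c\<bar> * (proj_norm z + d)"
    using u(2) by (intro mult_left_mono) auto
  also have "\<dots> \<le> \<bar>c\<bar> * proj_norm z + e"
    using d(2) by (simp add: algebra_simps)
  finally show "proj_norm (c *\<^sub>R z) \<le> \<bar>c\<bar> * proj_norm z + e" .
qed

lemma proj_norm_scaleR: "proj_norm (c *\<^sub>R z) = \<bar>c\<bar> * proj_norm z"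
proof (cases "c = 0")
  case False
  have "proj_norm (inverse c *\<^sub>R (c *\<^sub>R z)) \<le> \<bar>inverse c\<bar> * proj_norm (c *\<^sub>R z)"
    by (rule proj_norm_scaleR_le)
  then have "\<bar>c\<bar> * proj_norm z \<le> proj_norm (c *\<^sub>R z)"
    using False by (simp add: field_simps)
  with proj_norm_scaleR_le[of c z] show ?thesis by simp
qed simp

lemma proj_norm_minus: "proj_norm (- z) = proj_norm z"
  using proj_norm_scaleR[of "-1" z] by simp

lemma proj_norm_minus_commute: "proj_norm (z - w) = proj_norm (w - z)"
  using proj_norm_minus[of "z - w"] by simp

lemma proj_norm_diff_triangle: "proj_norm (z - w) \<le> proj_norm (z - v) + proj_norm (v - w)"
  using proj_norm_triangle[of "z - v" "v - w"] by simp

lemma proj_norm_diff: "\<bar>proj_norm z - proj_norm w\<bar> \<le> proj_norm (z - w)"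
  using proj_norm_triangle[of "z - w" w] proj_norm_triangle[of "w - z" z]
    proj_norm_minus_commute[of z w] by simp


section \<open>The completed projective tensor product\<close>

definition proj_cauchy ::
    "(nat \<Rightarrow> ('a::real_normed_vector, 'b::real_normed_vector) tensor) \<Rightarrow> bool"
  where "proj_cauchy s \<longleftrightarrow> (\<forall>e>0. \<exists>N. \<forall>m\<ge>N. \<forall>n\<ge>N. proj_norm (s m - s n) < e)"

definition proj_equiv ::
    "(nat \<Rightarrow> ('a::real_normed_vector, 'b::real_normed_vector) tensor) \<Rightarrow> (nat \<Rightarrow> ('a, 'b) tensor) \<Rightarrow> bool"
  where "proj_equiv s t \<longleftrightarrow>
    proj_cauchy s \<and> proj_cauchy t \<and> (\<lambda>n. proj_norm (s n - t n)) \<longlonglongrightarrow> 0"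

lemma proj_cauchy_const [simp]: "proj_cauchy (\<lambda>_. z)"
  by (simp add: proj_cauchy_def)

lemma proj_norm_LIMSEQ_dominated:
  assumes "f \<longlonglongrightarrow> 0" "\<And>n. proj_norm (s n) \<le> f n"
  shows "(\<lambda>n. proj_norm (s n)) \<longlonglongrightarrow> 0"
  by (rule tendsto_sandwich[OF _ _ tendsto_const assms(1)]) (auto simp: assms(2))

lemma proj_equiv_part_equivp: "part_equivp proj_equiv"
proof (rule part_equivpI)
  show "\<exists>s. proj_equiv s s"
    by (rule exI[of _ "\<lambda>_. 0"]) (simp add: proj_equiv_def)
  show "symp proj_equiv"
    by (auto simp: symp_def proj_equiv_def proj_norm_minus_commute)
  show "transp proj_equiv"
  proof (rule transpI)
    fix s t u
    assume st: "proj_equiv s t" and tu: "proj_equiv t u"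
    have "(\<lambda>n. proj_norm (s n - t n) + proj_norm (t n - u n)) \<longlonglongrightarrow> 0"
      using tendsto_add[of _ 0 sequentially _ 0] st tu by (fastforce simp: proj_equiv_def)
    then have "(\<lambda>n. proj_norm (s n - u n)) \<longlonglongrightarrow> 0"
      by (rule proj_norm_LIMSEQ_dominated) (rule proj_norm_diff_triangle)
    with st tu show "proj_equiv s u" by (auto simp: proj_equiv_def)
  qed
qed

text \<open>
  Cauchy sequences modulo null sequences. That the projective norm vanishes only at \<open>0\<close>
  (a consequence of the Hahn-Banach theorem) is not needed for this construction.
\<close>

quotient_type (overloaded) ('a, 'b) proj_tensor =
    "nat \<Rightarrow> ('a::real_normed_vector, 'b::real_normed_vector) tensor" / partial: proj_equiv
  by (rule proj_equiv_part_equivp)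

lemma proj_cauchy_add:
  assumes "proj_cauchy s" "proj_cauchy t"
  shows "proj_cauchy (\<lambda>n. s n + t n)"
  unfolding proj_cauchy_def
proof (intro allI impI)
  fix e :: real assume "e > 0"
  then obtain M N where
    M: "\<And>m n. m \<ge> M \<Longrightarrow> n \<ge> M \<Longrightarrow> proj_norm (s m - s n) < e/2" and
    N: "\<And>m n. m \<ge> N \<Longrightarrow> n \<ge> N \<Longrightarrow> proj_norm (t m - t n) < e/2"
    using assms unfolding proj_cauchy_def by (metis half_gt_zero)
  have "proj_norm ((s m + t m) - (s n + t n)) < e" if "m \<ge> max M N" "n \<ge> max M N" for m n
  proof -
    have "proj_norm ((s m - s n) + (t m - t n)) < e"
      using proj_norm_triangle[of "s m - s n" "t m - t n"] M[of m n] N[of m n] that by simp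
    then show ?thesis by (simp add: algebra_simps)
  qed
  then show "\<exists>N. \<forall>m\<ge>N. \<forall>n\<ge>N. proj_norm ((s m + t m) - (s n + t n)) < e" by blast
qed

lemma proj_cauchy_scaleR:
  assumes "proj_cauchy s"
  shows "proj_cauchy (\<lambda>n. c *\<^sub>R s n)"
  unfolding proj_cauchy_def
proof (intro allI impI)
  fix e :: real assume e: "e > 0"
  then have "e / (\<bar>c\<bar> + 1) > 0" by (simp add: add_nonneg_pos)
  then obtain N where
    N: "\<And>m n. m \<ge> N \<Longrightarrow> n \<ge> N \<Longrightarrow> proj_norm (s m - s n) < e / (\<bar>c\<bar> + 1)"
    using assms unfolding proj_cauchy_def by metis
  have "proj_norm (c *\<^sub>R s m - c *\<^sub>R s n) < e" if "m \<ge> N" "n \<ge> N" for m n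
  proof -
    have "proj_norm (c *\<^sub>R s m - c *\<^sub>R s n) = \<bar>c\<bar> * proj_norm (s m - s n)"
      by (simp add: proj_norm_scaleR flip: scaleR_diff_right)
    also have "\<dots> \<le> (\<bar>c\<bar> + 1) * proj_norm (s m - s n)"
      by (intro mult_right_mono) auto
    also have "\<dots> < e" using N[OF that] by (simp add: field_simps add_nonneg_pos)
    finally show ?thesis .
  qed
  then show "\<exists>N. \<forall>m\<ge>N. \<forall>n\<ge>N. proj_norm (c *\<^sub>R s m - c *\<^sub>R s n) < e" by blast
qed

lemma proj_equiv_add:
  assumes "proj_equiv s s'" "proj_equiv t t'"
  shows "proj_equiv (\<lambda>n. s n + t n) (\<lambda>n. s' n + t' n)"
proof -
  have "(\<lambda>n. proj_norm (s n - s' n) + proj_norm (t n - t' n)) \<longlonglongrightarrow> 0"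
    using tendsto_add[of _ 0 sequentially _ 0] assms by (fastforce simp: proj_equiv_def)
  then have "(\<lambda>n. proj_norm ((s n + t n) - (s' n + t' n))) \<longlonglongrightarrow> 0"
    by (rule proj_norm_LIMSEQ_dominated) (metis add_diff_add proj_norm_triangle)
  with assms show ?thesis by (auto simp: proj_equiv_def proj_cauchy_add)
qed

lemma proj_equiv_scaleR:
  assumes "proj_equiv s t"
  shows "proj_equiv (\<lambda>n. c *\<^sub>R s n) (\<lambda>n. c *\<^sub>R t n)"
proof -
  have "(\<lambda>n. \<bar>c\<bar> * proj_norm (s n - t n)) \<longlonglongrightarrow> 0"
    using assms tendsto_mult_right_zero by (fastforce simp: proj_equiv_def)
  then have "(\<lambda>n. proj_norm (c *\<^sub>R s n - c *\<^sub>R t n)) \<longlonglongrightarrow> 0"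
    by (simp add: proj_norm_scaleR flip: scaleR_diff_right)
  with assms show ?thesis by (auto simp: proj_equiv_def proj_cauchy_scaleR)
qed

lemma proj_cauchy_norm_convergent:
  assumes "proj_cauchy s"
  shows "(\<lambda>n. proj_norm (s n)) \<longlonglongrightarrow> lim (\<lambda>n. proj_norm (s n))"
proof -
  have "Cauchy (\<lambda>n. proj_norm (s n))"
    unfolding Cauchy_def dist_real_def
    using assms unfolding proj_cauchy_def by (meson proj_norm_diff le_less_trans)
  then show ?thesis
    by (simp add: Cauchy_convergent_iff convergent_LIMSEQ_iff)
qed

lemma proj_equiv_norm_lim:
  assumes "proj_equiv s t"
  shows "lim (\<lambda>n. proj_norm (s n)) = lim (\<lambda>n. proj_norm (t n))"
proof -
  have "(\<lambda>n. proj_norm (s n) - proj_norm (t n)) \<longlonglongrightarrow> 0"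
    by (rule Lim_null_comparison[of _ "\<lambda>n. proj_norm (s n - t n)"])
       (use assms in \<open>auto simp: proj_equiv_def proj_norm_diff\<close>)
  moreover have "(\<lambda>n. proj_norm (s n) - proj_norm (t n)) \<longlonglongrightarrow>
      lim (\<lambda>n. proj_norm (s n)) - lim (\<lambda>n. proj_norm (t n))"
    using assms by (intro tendsto_diff proj_cauchy_norm_convergent) (auto simp: proj_equiv_def)
  ultimately show ?thesis using LIMSEQ_unique by fastforce
qed

instantiation proj_tensor :: (real_normed_vector, real_normed_vector) real_normed_vector
begin

lift_definition zero_proj_tensor :: "('a, 'b) proj_tensor" is "\<lambda>_. 0"
  by (simp add: proj_equiv_def)

lift_definition plus_proj_tensor ::
    "('a, 'b) proj_tensor \<Rightarrow> ('a, 'b) proj_tensor \<Rightarrow> ('a, 'b) proj_tensor"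
  is "\<lambda>s t n. s n + t n" by (rule proj_equiv_add)

lift_definition scaleR_proj_tensor :: "real \<Rightarrow> ('a, 'b) proj_tensor \<Rightarrow> ('a, 'b) proj_tensor"
  is "\<lambda>c s n. c *\<^sub>R s n" by (rule proj_equiv_scaleR)

lift_definition norm_proj_tensor :: "('a, 'b) proj_tensor \<Rightarrow> real"
  is "\<lambda>s. lim (\<lambda>n. proj_norm (s n))" by (rule proj_equiv_norm_lim)

definition uminus_proj_tensor :: "('a, 'b) proj_tensor \<Rightarrow> ('a, 'b) proj_tensor"
  where "uminus_proj_tensor z = (-1) *\<^sub>R z"

definition minus_proj_tensor ::
    "('a, 'b) proj_tensor \<Rightarrow> ('a, 'b) proj_tensor \<Rightarrow> ('a, 'b) proj_tensor"
  where "minus_proj_tensor z w = z + - w"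

definition sgn_proj_tensor :: "('a, 'b) proj_tensor \<Rightarrow> ('a, 'b) proj_tensor"
  where "sgn_proj_tensor z = inverse (norm z) *\<^sub>R z"

definition dist_proj_tensor :: "('a, 'b) proj_tensor \<Rightarrow> ('a, 'b) proj_tensor \<Rightarrow> real"
  where "dist_proj_tensor z w = norm (z - w)"

definition uniformity_proj_tensor :: "(('a, 'b) proj_tensor \<times> ('a, 'b) proj_tensor) filter"
  where [code del]:
    "uniformity_proj_tensor = (INF e\<in>{0<..}. principal {(x, y). dist x y < e})"

definition open_proj_tensor :: "('a, 'b) proj_tensor set \<Rightarrow> bool"
  where [code del]: "open_proj_tensor S =
    (\<forall>x\<in>S. \<forall>\<^sub>F (x', y) in uniformity. x' = x \<longrightarrow> y \<in> S)"

instance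
proof
  fix a b c :: "('a, 'b) proj_tensor" and r s :: real and S :: "('a, 'b) proj_tensor set"
  have refl: "proj_equiv s t" if "proj_equiv s s" "\<And>n. s n = t n"
    for s t :: "nat \<Rightarrow> ('a, 'b) tensor"
    using that by (metis ext)
  show "a + b + c = a + (b + c)"
    by transfer (rule refl; simp add: proj_equiv_add add.assoc)
  show "a + b = b + a"
    by transfer (rule refl; simp add: proj_equiv_add add.commute)
  show "0 + a = a"
    by transfer simp
  show "- a + a = 0"
    unfolding uminus_proj_tensor_def by transfer (simp add: proj_equiv_def)
  show "a - b = a + - b"
    unfolding minus_proj_tensor_def ..
  show "r *\<^sub>R (a + b) = r *\<^sub>R a + r *\<^sub>R b"
    by transfer (rule refl; simp add: proj_equiv_add proj_equiv_scaleR scaleR_add_right)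
  show "(r + s) *\<^sub>R a = r *\<^sub>R a + s *\<^sub>R a"
    by transfer (rule refl; simp add: proj_equiv_add proj_equiv_scaleR scaleR_add_left)
  show "r *\<^sub>R s *\<^sub>R a = (r * s) *\<^sub>R a"
    by transfer (simp add: proj_equiv_scaleR)
  show "1 *\<^sub>R a = a"
    by transfer simp
  show "sgn a = inverse (norm a) *\<^sub>R a"
    by (simp add: sgn_proj_tensor_def)
  show "dist a b = norm (a - b)"
    by (rule dist_proj_tensor_def)
  show "uniformity = (INF e\<in>{0<..}. principal {(x, y). dist (x :: ('a, 'b) proj_tensor) y < e})"
    by (rule uniformity_proj_tensor_def)
  show "open S = (\<forall>x\<in>S. \<forall>\<^sub>F (x', y) in uniformity. x' = x \<longrightarrow> y \<in> S)"
    by (rule open_proj_tensor_def)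
  show "norm a = 0 \<longleftrightarrow> a = 0"
  proof transfer
    fix s :: "nat \<Rightarrow> ('a, 'b) tensor"
    assume "proj_equiv s s"
    then have c: "proj_cauchy s" by (simp add: proj_equiv_def)
    from proj_cauchy_norm_convergent[OF c]
    show "lim (\<lambda>n. proj_norm (s n)) = 0 \<longleftrightarrow> proj_equiv s (\<lambda>_. 0)"
      using c by (auto simp: proj_equiv_def dest: limI)
  qed
  show "norm (a + b) \<le> norm a + norm b"
  proof transfer
    fix s t :: "nat \<Rightarrow> ('a, 'b) tensor"
    assume "proj_equiv s s" "proj_equiv t t"
    then have "proj_cauchy s" "proj_cauchy t" by (auto simp: proj_equiv_def)
    then show "lim (\<lambda>n. proj_norm (s n + t n)) \<le>
        lim (\<lambda>n. proj_norm (s n)) + lim (\<lambda>n. proj_norm (t n))"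
      by (intro LIMSEQ_le[OF proj_cauchy_norm_convergent
            tendsto_add[OF proj_cauchy_norm_convergent proj_cauchy_norm_convergent]]
          proj_cauchy_add) (auto simp: proj_norm_triangle)
  qed
  show "norm (r *\<^sub>R a) = \<bar>r\<bar> * norm a"
  proof transfer
    fix r :: real and s :: "nat \<Rightarrow> ('a, 'b) tensor"
    assume "proj_equiv s s"
    then have "proj_cauchy s" by (auto simp: proj_equiv_def)
    then show "lim (\<lambda>n. proj_norm (r *\<^sub>R s n)) = \<bar>r\<bar> * lim (\<lambda>n. proj_norm (s n))"
      by (intro limI) (auto simp: proj_norm_scaleR intro!: tendsto_intros proj_cauchy_norm_convergent)
  qed
qed

end

definition of_tensor ::
    "('a::real_normed_vector, 'b::real_normed_vector) tensor \<Rightarrow> ('a, 'b) proj_tensor"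
  where "of_tensor z = abs_proj_tensor (\<lambda>_. z)"

lemma proj_equiv_const: "proj_equiv (\<lambda>_. z) (\<lambda>_. z)"
  by (simp add: proj_equiv_def)

lemma linear_of_tensor: "linear of_tensor"
  by (rule linearI)
     (simp_all add: of_tensor_def plus_proj_tensor.abs_eq scaleR_proj_tensor.abs_eq proj_equiv_const)

lemma norm_of_tensor: "norm (of_tensor z) = proj_norm z"
  by (simp add: of_tensor_def norm_proj_tensor.abs_eq proj_equiv_const)

lemma of_tensor_LIMSEQ:
  assumes s: "proj_cauchy s"
  shows "(\<lambda>n. of_tensor (s n)) \<longlonglongrightarrow> abs_proj_tensor s"
proof (rule metric_LIMSEQ_I)
  fix e :: real assume e: "e > 0"
  then obtain N where N: "\<And>m n. m \<ge> N \<Longrightarrow> n \<ge> N \<Longrightarrow> proj_norm (s m - s n) < e/2"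
    using s unfolding proj_cauchy_def by (metis half_gt_zero)
  have ss: "proj_equiv s s" using s by (simp add: proj_equiv_def)
  have "dist (of_tensor (s m)) (abs_proj_tensor s) < e" if m: "m \<ge> N" for m
  proof -
    have cc: "proj_equiv (\<lambda>_. s m) (\<lambda>_. s m)" by (simp add: proj_equiv_def)
    have ms: "proj_equiv (\<lambda>n. (-1) *\<^sub>R s n) (\<lambda>n. (-1) *\<^sub>R s n)"
      by (rule proj_equiv_scaleR[OF ss])
    have ad: "proj_equiv (\<lambda>n. s m + (-1) *\<^sub>R s n) (\<lambda>n. s m + (-1) *\<^sub>R s n)"
      by (rule proj_equiv_add[OF cc ms])
    have "of_tensor (s m) - abs_proj_tensor s = abs_proj_tensor (\<lambda>n. s m + (-1) *\<^sub>R s n)"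
      unfolding minus_proj_tensor_def uminus_proj_tensor_def of_tensor_def
      by (simp only: scaleR_proj_tensor.abs_eq[OF ss] plus_proj_tensor.abs_eq[OF cc ms])
    then have eq: "dist (of_tensor (s m)) (abs_proj_tensor s) = lim (\<lambda>n. proj_norm (s m + (-1) *\<^sub>R s n))"
      by (simp only: dist_norm norm_proj_tensor.abs_eq[OF ad])
    have "(\<lambda>n. proj_norm (s m + (-1) *\<^sub>R s n)) \<longlonglongrightarrow> lim (\<lambda>n. proj_norm (s m + (-1) *\<^sub>R s n))"
      using ad by (intro proj_cauchy_norm_convergent) (simp add: proj_equiv_def)
    moreover have "\<forall>n\<ge>N. proj_norm (s m + (-1) *\<^sub>R s n) \<le> e/2"
      using N[OF m] by (auto intro: less_imp_le)
    ultimately have "lim (\<lambda>n. proj_norm (s m + (-1) *\<^sub>R s n)) \<le> e/2"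
      by (blast intro: LIMSEQ_le_const2)
    with e eq show ?thesis by simp
  qed
  then show "\<exists>N. \<forall>n\<ge>N. dist (of_tensor (s n)) (abs_proj_tensor s) < e" by blast
qed

lemma proj_tensor_cases:
  obtains s where "proj_cauchy s" "z = abs_proj_tensor s"
proof
  show "z = abs_proj_tensor (rep_proj_tensor z)"
    by (simp only: Quotient_abs_rep[OF Quotient_proj_tensor])
  show "proj_cauchy (rep_proj_tensor z)"
    using Quotient_rep_reflp[OF Quotient_proj_tensor, of z] by (simp add: proj_equiv_def)
qed

lemma of_tensor_dense: "closure (range of_tensor) = UNIV"
proof -
  have "z \<in> closure (range of_tensor)" for z :: "('a, 'b) proj_tensor"
  proof (cases z rule: proj_tensor_cases)
    case (1 s)
    show ?thesis
      unfolding closure_sequential 1(2)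
      by (rule exI[of _ "\<lambda>n. of_tensor (s n)"]) (simp add: of_tensor_LIMSEQ[OF 1(1)])
  qed
  then show ?thesis by auto
qed

instance proj_tensor :: (real_normed_vector, real_normed_vector) banach
proof
  fix X :: "nat \<Rightarrow> ('a, 'b) proj_tensor"
  assume X: "Cauchy X"
  have "\<exists>z. dist (of_tensor z) (X n) < inverse (real (Suc n))" for n
  proof -
    have "X n \<in> closure (range of_tensor)" by (simp add: of_tensor_dense)
    then show ?thesis unfolding closure_approachable
      by (metis (mono_tags, lifting) imageE inverse_positive_iff_positive of_nat_0_less_iff zero_less_Suc)
  qed
  then obtain z where z: "\<And>n. dist (of_tensor (z n)) (X n) < inverse (real (Suc n))" by metis
  have lim0: "(\<lambda>n. dist (of_tensor (z n)) (X n)) \<longlonglongrightarrow> 0"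
    by (rule tendsto_sandwich[OF _ _ tendsto_const LIMSEQ_inverse_real_of_nat])
       (simp_all add: less_imp_le[OF z] del: of_nat_Suc)
  have "proj_cauchy z"
    unfolding proj_cauchy_def
  proof (intro allI impI)
    fix e :: real assume "e > 0"
    then have e3: "e/3 > 0" by simp
    obtain M where M: "\<And>m n. m \<ge> M \<Longrightarrow> n \<ge> M \<Longrightarrow> dist (X m) (X n) < e/3"
      using metric_CauchyD[OF X e3] by blast
    obtain N where N: "\<And>n. n \<ge> N \<Longrightarrow> dist (of_tensor (z n)) (X n) < e/3"
      using metric_LIMSEQ_D[OF lim0 e3] by (auto simp: dist_real_def)
    have "proj_norm (z m - z n) < e" if "m \<ge> max M N" "n \<ge> max M N" for m n
    proof -
      have "proj_norm (z m - z n) = dist (of_tensor (z m)) (of_tensor (z n))"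
        by (simp add: dist_norm linear_diff[OF linear_of_tensor, symmetric] norm_of_tensor)
      also have "\<dots> \<le> dist (of_tensor (z m)) (X m) + dist (X m) (X n) + dist (of_tensor (z n)) (X n)"
        by (smt (verit) dist_triangle2 dist_commute)
      also have "\<dots> < e" using M[of m n] N[of m] N[of n] that by simp
      finally show ?thesis .
    qed
    then show "\<exists>N. \<forall>m\<ge>N. \<forall>n\<ge>N. proj_norm (z m - z n) < e" by blast
  qed
  then have "(\<lambda>n. of_tensor (z n)) \<longlonglongrightarrow> abs_proj_tensor z" by (rule of_tensor_LIMSEQ)
  moreover have "(\<lambda>n. of_tensor (z n) - X n) \<longlonglongrightarrow> 0"
    using lim0 by (simp add: dist_norm tendsto_norm_zero_iff)
  ultimately have "(\<lambda>n. of_tensor (z n) - (of_tensor (z n) - X n)) \<longlonglongrightarrow> abs_proj_tensor z - 0"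
    by (rule tendsto_diff)
  then have "X \<longlonglongrightarrow> abs_proj_tensor z" by simp
  then show "convergent X" by (auto simp: convergent_def)
qed


section \<open>Properties of Banach spaces and operators\<close>

definition strongly_subdifferentiable :: "'z::real_normed_vector itself \<Rightarrow> bool"
  where "strongly_subdifferentiable _ \<longleftrightarrow>
    (\<forall>z :: 'z. norm z = 1 \<longrightarrow>
      (\<exists>l. uniform_limit (sphere 0 1)
        (\<lambda>(t::real) h. (norm (z + t *\<^sub>R h) - norm z) / t) l (at_right 0)))"

definition finite_rank :: "('a::real_normed_vector \<Rightarrow>\<^sub>L 'b::real_normed_vector) \<Rightarrow> bool"
  where "finite_rank S \<longleftrightarrow> (\<exists>B. finite B \<and> range (blinfun_apply S) \<subseteq> span B)"

text \<open>
  A net of operators is rendered as a proper filter on the operator space (the filter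
  generated by its tails); conversely a proper filter \<open>F\<close> gives a net indexed by the pairs
  \<open>(P, S)\<close> with \<open>S \<in> P\<close> and \<open>P\<close> a member of \<open>F\<close>.
\<close>

definition metric_approximation_property :: "'a::real_normed_vector itself \<Rightarrow> bool"
  where "metric_approximation_property _ \<longleftrightarrow>
    (\<exists>F :: ('a \<Rightarrow>\<^sub>L 'a) filter. F \<noteq> bot \<and>
      (\<forall>\<^sub>F S in F. finite_rank S \<and> norm S \<le> 1) \<and>
      (\<forall>x. ((\<lambda>S. blinfun_apply S x) \<longlongrightarrow> x) F))"

definition compact_operator :: "('a::real_normed_vector \<Rightarrow>\<^sub>L 'b::real_normed_vector) \<Rightarrow> bool"
  where "compact_operator T \<longleftrightarrow> compact (closure (blinfun_apply T ` cball 0 1))"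

lift_definition bidual_embedding :: "'a::real_normed_vector \<Rightarrow> (('a \<Rightarrow>\<^sub>L real) \<Rightarrow>\<^sub>L real)"
  is "\<lambda>x f. blinfun_apply f x" by (rule blinfun.bounded_linear_left)

definition reflexive_space :: "'a::real_normed_vector itself \<Rightarrow> bool"
  where "reflexive_space _ \<longleftrightarrow> surj (bidual_embedding :: 'a \<Rightarrow> _)"

end

theory Submission
  imports Defs
begin

text \<open>
  The argument rests on a form of Simons' inequality, used twice. Let \<open>E\<close> be a Banach space and \<open>N\<close> a subspace
  of its dual. If every vector of \<open>E\<close> attains its norm at a functional close to a separable part of \<open>N\<close> that
  can be predicted from vectors nearby, then \<open>N\<close> is dense: otherwise some \<open>f\<close> has positive distance
  to \<open>N\<close>, Helly's theorem yields a sequence in the unit ball on which \<open>f\<close> stays large while more and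
  more of the predicted functionals vanish, and Simons' inequality gives a point in its closed convex hull
  whose norming functionals are all large somewhere on every tail of the sequence.

  For \<open>E\<close> the tensor product, strong subdifferentiability says that functionals almost norming \<open>z\<close> are close
  to functionals norming \<open>z\<close>, and the metric approximation property makes the finite sums of functionals
  \<open>x \<otimes> y \<mapsto> f x * g y\<close> norming; hence they are dense in the dual and every operator is compact. For \<open>E\<close> the
  dual of the tensor product of reflexive spaces and \<open>N\<close> the image of the tensor product in its bidual, density
  of the finite sums makes \<open>x \<otimes> y\<close> jointly weakly continuous on bounded sets, so that norms are attained at
  elementary tensors, and these depend on \<open>\<phi>\<close> in the required way by Mazur's theorem.
\<close>

section \<open>The Hahn-Banach theorem\<close>

definition sublinear :: "('v::real_vector \<Rightarrow> real) \<Rightarrow> bool"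
  where "sublinear p \<longleftrightarrow> (\<forall>x y. p (x + y) \<le> p x + p y) \<and> (\<forall>c>0. \<forall>x. p (c *\<^sub>R x) = c * p x) \<and> p 0 = 0"

text \<open>One inequality for positive multiples suffices: applied with \<open>inverse c\<close> at
  \<open>c *\<^sub>R x\<close> it yields the reverse one.\<close>

lemma sublinearI:
  assumes "\<And>x y. p (x + y) \<le> p x + p y" "\<And>c x. c > 0 \<Longrightarrow> p (c *\<^sub>R x) \<le> c * p x" "p 0 = 0"
  shows "sublinear p"
proof -
  have "c * p x \<le> p (c *\<^sub>R x)" if "c > 0" for c x
    using assms(2)[of "inverse c" "c *\<^sub>R x"] that by (simp add: field_simps)
  then have "p (c *\<^sub>R x) = c * p x" if "c > 0" for c x
    using assms(2) that by (intro order_antisym)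
  then show ?thesis
    using assms(1,3) by (simp add: sublinear_def)
qed

lemma sublinearD:
  assumes "sublinear p"
  shows "p (x + y) \<le> p x + p y" "c \<ge> 0 \<Longrightarrow> p (c *\<^sub>R x) = c * p x" "p 0 = 0" "- p (- x) \<le> p x"
proof -
  show "c \<ge> 0 \<Longrightarrow> p (c *\<^sub>R x) = c * p x"
    using assms by (cases "c = 0") (auto simp: sublinear_def)
  have "p (x + - x) \<le> p x + p (- x)" using assms unfolding sublinear_def by blast
  then show "- p (- x) \<le> p x" using assms by (simp add: sublinear_def)
qed (use assms in \<open>auto simp: sublinear_def\<close>)

lemma sublinear_norm: "c \<ge> 0 \<Longrightarrow> sublinear (\<lambda>x. c * norm x)"
  by (rule sublinearI) (auto simp flip: distrib_left intro: mult_left_mono norm_triangle_ineq)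

text \<open>For fixed \<open>a\<close>, the infimum over \<open>t \<ge> 0\<close> of
  \<open>q (x + t *\<^sub>R a) - t * q a\<close> is again sublinear in \<open>x\<close> and lies
  below \<open>q\<close>, hence equals \<open>q\<close> by minimality. Its term at
  \<open>t = 1\<close> then gives superadditivity.\<close>

lemma minimal_sublinear_linear:
  assumes q: "sublinear q" and min: "\<And>q'. sublinear q' \<Longrightarrow> q' \<le> q \<Longrightarrow> q' = q"
  shows "linear q"
proof -
  note qD = sublinearD[OF q]
  have super: "q x + q a \<le> q (x + a)" for a x
  proof -
    define r where "r x = (INF t\<in>{0..}. q (x + t *\<^sub>R a) - t * q a)" for x
    have lower: "- q (- x) \<le> q (x + t *\<^sub>R a) - t * q a" if "t \<ge> 0" for t x
      using qD(1)[of "x + t *\<^sub>R a" "- x"] qD(2)[of t a] that by simp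
    have r_le: "r x \<le> q (x + t *\<^sub>R a) - t * q a" if "t \<ge> 0" for t x
      unfolding r_def by (rule cINF_lower) (use lower that in \<open>auto intro!: bdd_belowI2[of _ "- q (- x)"]\<close>)
    have r_ge: "m \<le> r x" if "\<And>t. t \<ge> 0 \<Longrightarrow> m \<le> q (x + t *\<^sub>R a) - t * q a" for m x
      unfolding r_def by (rule cINF_greatest) (use that in auto)
    have "sublinear r"
    proof (rule sublinearI)
      fix x y
      have "r (x + y) - (q (y + t *\<^sub>R a) - t * q a) \<le> r x" if "t \<ge> 0" for t
      proof (rule r_ge)
        fix s :: real assume "s \<ge> 0"
        then show "r (x + y) - (q (y + t *\<^sub>R a) - t * q a) \<le> q (x + s *\<^sub>R a) - s * q a"
          using r_le[of "s + t" "x + y"] that qD(1)[of "x + s *\<^sub>R a" "y + t *\<^sub>R a"]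
          by (simp add: algebra_simps)
      qed
      then have "r (x + y) - r x \<le> r y" by (intro r_ge) (simp add: algebra_simps)
      then show "r (x + y) \<le> r x + r y" by simp
    next
      fix c :: real and x assume c: "c > 0"
      have "r (c *\<^sub>R x) / c \<le> r x"
      proof (rule r_ge)
        fix t :: real assume t: "t \<ge> 0"
        have "r (c *\<^sub>R x) \<le> q (c *\<^sub>R (x + t *\<^sub>R a)) - (c * t) * q a"
          using r_le[of "c * t" "c *\<^sub>R x"] c t by (simp add: scaleR_add_right)
        also have "\<dots> = c * (q (x + t *\<^sub>R a) - t * q a)"
          using c by (simp add: qD(2) right_diff_distrib)
        finally show "r (c *\<^sub>R x) / c \<le> q (x + t *\<^sub>R a) - t * q a"
          using c by (simp add: field_simps)
      qed
      then show "r (c *\<^sub>R x) \<le> c * r x" using c by (simp add: field_simps)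
    next
      show "r 0 = 0"
      proof (rule order_antisym)
        show "r 0 \<le> 0" using r_le[of 0 0] by (simp add: qD(3))
        show "0 \<le> r 0" by (rule r_ge) (simp add: qD(2))
      qed
    qed
    moreover have "r \<le> q" using r_le[of 0] by (auto simp: le_fun_def)
    ultimately have "r = q" by (rule min)
    then show ?thesis using r_le[of 1 x] by simp
  qed
  have add: "q (x + y) = q x + q y" for x y
    using super[of x y] qD(1)[of x y] by (rule order_antisym[rotated])
  have minus: "q (- x) = - q x" for x using add[of x "- x"] qD(3) by simp
  show ?thesis
  proof (rule linearI)
    fix c x show "q (c *\<^sub>R x) = c *\<^sub>R q x"
    proof (cases "c \<ge> 0")
      case False
      then have "q ((- c) *\<^sub>R x) = (- c) * q x" by (intro qD(2)) simp
      then show ?thesis using minus[of "(- c) *\<^sub>R x"] by simp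
    qed (simp add: qD(2))
  qed (rule add)
qed

text \<open>Zorn's lemma, with the order reversed, gives a minimal sublinear function below
  \<open>p\<close>; a chain is bounded by its pointwise infimum, which is finite because every
  member is at least \<open>- p (- x)\<close> at \<open>x\<close>.\<close>

lemma linear_below_sublinear:
  assumes p: "sublinear p"
  obtains F where "linear F" "\<And>x. F x \<le> p x"
proof -
  define A where "A = {q. sublinear q \<and> q \<le> p}"
  have "\<exists>m\<in>A. \<forall>a\<in>A. (\<lambda>a b. b \<le> a) m a \<longrightarrow> a = m"
  proof (rule predicate_Zorn)
    show "partial_order_on A (relation_of (\<lambda>a b. b \<le> a) A)"
      by (rule partial_order_on_relation_ofI) auto
  next
    fix C assume "C \<in> Chains (relation_of (\<lambda>a b. b \<le> a) A)"
    then have CA: "C \<subseteq> A" and ch: "\<And>a b. a \<in> C \<Longrightarrow> b \<in> C \<Longrightarrow> a \<le> b \<or> b \<le> a"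
      by (auto simp: Chains_def relation_of_def)
    show "\<exists>u\<in>A. \<forall>a\<in>C. u \<le> a"
    proof (cases "C = {}")
      case True
      then show ?thesis using p by (auto simp: A_def)
    next
      case False
      define u where "u x = (INF q\<in>C. q x)" for x
      have CD: "sublinear q" "q x \<le> p x" if "q \<in> C" for q x
        using CA that by (auto simp: A_def le_fun_def)
      have u_le: "u x \<le> q x" if "q \<in> C" for q x
        unfolding u_def
      proof (rule cINF_lower)
        show "bdd_below ((\<lambda>q. q x) ` C)"
        proof (rule bdd_belowI2)
          show "- p (- x) \<le> q x" if "q \<in> C" for q
            using sublinearD(4)[OF CD(1)[OF that], of x] CD(2)[OF that, of "- x"] by simp
        qed
      qed fact
      have u_ge: "m \<le> u x" if "\<And>q. q \<in> C \<Longrightarrow> m \<le> q x" for m x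
        unfolding u_def by (rule cINF_greatest) (use False that in auto)
      have "sublinear u"
      proof (rule sublinearI)
        fix x y
        \<comment> \<open>Of two comparable members of the chain, the smaller one serves both
          arguments.\<close>
        have "u (x + y) \<le> q x + q' y" if "q \<in> C" "q' \<in> C" for q q'
          using ch[OF that] u_le[OF that(1), of "x + y"] u_le[OF that(2), of "x + y"]
            sublinearD(1)[OF CD(1)[OF that(1)], of x y] sublinearD(1)[OF CD(1)[OF that(2)], of x y]
          by (auto simp: le_fun_def) (smt (verit))+
        then have "u (x + y) - q' y \<le> u x" if "q' \<in> C" for q'
          using that by (intro u_ge) (simp add: algebra_simps)
        then have "u (x + y) - u x \<le> u y" by (intro u_ge) (simp add: algebra_simps)
        then show "u (x + y) \<le> u x + u y" by simp
      next
        fix c :: real and x assume c: "c > 0"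
        have "u (c *\<^sub>R x) / c \<le> u x"
          using u_le[of _ "c *\<^sub>R x"] c sublinearD(2)[OF CD(1)]
          by (intro u_ge) (fastforce simp: field_simps)
        then show "u (c *\<^sub>R x) \<le> c * u x" using c by (simp add: field_simps)
      next
        show "u 0 = 0" using False by (simp add: u_def sublinearD(3)[OF CD(1)])
      qed
      moreover have "u \<le> p" using False by (metis all_not_in_conv u_le CD(2) order_trans le_funI)
      ultimately show ?thesis using u_le by (auto simp: A_def le_fun_def)
    qed
  qed
  then obtain m where m: "m \<in> A" "\<And>a. a \<in> A \<Longrightarrow> a \<le> m \<Longrightarrow> a = m" by auto
  have "linear m"
    by (rule minimal_sublinear_linear) (use m in \<open>auto simp: A_def\<close>)
  with m(1) that show thesis by (auto simp: A_def le_fun_def)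
qed

text \<open>Taking \<open>A\<close> to be an inclusion gives the usual extension form; the map is convenient because
  most subspaces below are ranges of linear maps.\<close>

theorem hahn_banach:
  fixes A :: "'u::real_vector \<Rightarrow> 'v::real_vector" and g :: "'u \<Rightarrow> real"
  assumes p: "sublinear p" and A: "linear A" and g: "linear g" and L: "subspace L"
    and le: "\<And>u. u \<in> L \<Longrightarrow> g u \<le> p (A u)"
  obtains F where "linear F" "\<And>u. u \<in> L \<Longrightarrow> F (A u) = g u" "\<And>v. F v \<le> p v"
proof -
  note pD = sublinearD[OF p]
  \<comment> \<open>Since \<open>0 \<in> L\<close>, \<open>q\<close> lies below \<open>p\<close>,
    and \<open>q (A u) \<le> g u\<close> on \<open>L\<close>. A linear \<open>F\<close> below
    \<open>q\<close> thus satisfies \<open>F (A u) \<le> g u\<close>, and the same at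
    \<open>- u\<close> turns this into equality.\<close>
  define q where "q v = (INF u\<in>L. p (v - A u) + g u)" for v
  have lower: "- p (- v) \<le> p (v - A u) + g u" if "u \<in> L" for u v
    using le[of "- u"] that L pD(1)[of "v - A u" "- v"]
    by (simp add: linear_neg[OF A] linear_neg[OF g] subspace_neg)
  have q_le: "q v \<le> p (v - A u) + g u" if "u \<in> L" for u v
    unfolding q_def by (rule cINF_lower) (use lower that in \<open>auto intro!: bdd_belowI2[of _ "- p (- v)"]\<close>)
  have q_ge: "m \<le> q v" if "\<And>u. u \<in> L \<Longrightarrow> m \<le> p (v - A u) + g u" for m v
    unfolding q_def by (rule cINF_greatest) (use that subspace_0[OF L] in auto)
  have "sublinear q"
  proof (rule sublinearI)
    fix x y
    have "q (x + y) - (p (y - A u) + g u) \<le> q x" if "u \<in> L" for u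
    proof (rule q_ge)
      fix w assume "w \<in> L"
      then show "q (x + y) - (p (y - A u) + g u) \<le> p (x - A w) + g w"
        using q_le[of "w + u" "x + y"] that L pD(1)[of "x - A w" "y - A u"]
        by (simp add: subspace_add linear_add[OF A] linear_add[OF g] algebra_simps)
    qed
    then have "q (x + y) - q x \<le> q y" by (intro q_ge) (simp add: algebra_simps)
    then show "q (x + y) \<le> q x + q y" by simp
  next
    fix c :: real and x assume c: "c > 0"
    have "q (c *\<^sub>R x) / c \<le> q x"
    proof (rule q_ge)
      fix u assume u: "u \<in> L"
      have "q (c *\<^sub>R x) \<le> p (c *\<^sub>R (x - A u)) + c * g u"
        using q_le[of "c *\<^sub>R u" "c *\<^sub>R x"] u L
        by (simp add: subspace_scale linear_scale[OF A] linear_scale[OF g] scaleR_diff_right)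
      also have "\<dots> = c * (p (x - A u) + g u)"
        using c by (simp add: pD(2) distrib_left)
      finally show "q (c *\<^sub>R x) / c \<le> p (x - A u) + g u"
        using c by (simp add: field_simps)
    qed
    then show "q (c *\<^sub>R x) \<le> c * q x" using c by (simp add: field_simps)
  next
    show "q 0 = 0"
    proof (rule order_antisym)
      show "q 0 \<le> 0"
        using q_le[of 0 0] subspace_0[OF L] by (simp add: pD(3) linear_0[OF A] linear_0[OF g])
      show "0 \<le> q 0" by (rule q_ge) (use lower[of _ 0] pD(3) in simp)
    qed
  qed
  then obtain F where F: "linear F" "\<And>x. F x \<le> q x" using linear_below_sublinear by blast
  have F_le: "F (A u) \<le> g u" if "u \<in> L" for u
    using F(2)[of "A u"] q_le[OF that, of "A u"] pD(3) by simp
  have "F (A u) = g u" if "u \<in> L" for u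
    using F_le[OF that] F_le[of "- u"] that L
    by (simp add: subspace_neg linear_neg[OF A] linear_neg[OF g] linear_neg[OF F(1)])
  moreover have "F v \<le> p v" for v
    using F(2)[of v] q_le[of 0 v] subspace_0[OF L] by (simp add: linear_0[OF A] linear_0[OF g])
  ultimately show thesis using that F(1) by blast
qed

lemma linear_bounded_blinfun:
  assumes F: "linear F" and le: "\<And>v. F v \<le> c * norm v" and c: "c \<ge> 0"
  obtains f :: "'v::real_normed_vector \<Rightarrow>\<^sub>L real" where "blinfun_apply f = F" "norm f \<le> c"
proof -
  have abs: "norm (F v) \<le> c * norm v" for v
    using le[of v] le[of "- v"] by (simp add: linear_neg[OF F])
  have "bounded_linear F"
    by (rule bounded_linear.intro[OF F]) (use abs in \<open>auto simp: bounded_linear_axioms_def mult.commute\<close>)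
  then have "blinfun_apply (Blinfun F) = F" by (rule bounded_linear_Blinfun_apply)
  moreover from this have "norm (Blinfun F) \<le> c"
    using abs by (intro norm_blinfun_bound c) (simp only:)
  ultimately show thesis by (rule that)
qed

theorem hahn_banach_norm:
  fixes A :: "'u::real_vector \<Rightarrow> 'v::real_normed_vector" and g :: "'u \<Rightarrow> real"
  assumes "c \<ge> 0" "linear A" "linear g" "subspace L" "\<And>u. u \<in> L \<Longrightarrow> g u \<le> c * norm (A u)"
  obtains f :: "'v \<Rightarrow>\<^sub>L real" where "\<And>u. u \<in> L \<Longrightarrow> f (A u) = g u" "norm f \<le> c"
proof -
  obtain F where F: "linear F" "\<And>u. u \<in> L \<Longrightarrow> F (A u) = g u" "\<And>v. F v \<le> c * norm v"
    using hahn_banach[OF sublinear_norm assms(2-5)] assms(1) by blast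
  show thesis
    using linear_bounded_blinfun[OF F(1,3) assms(1)] F(2) that by metis
qed

lemma norming_functional:
  fixes z :: "'v::real_normed_vector"
  obtains f :: "'v \<Rightarrow>\<^sub>L real" where "f z = norm z" "norm f \<le> 1"
proof (rule hahn_banach_norm[of 1 "\<lambda>t. t *\<^sub>R z" "\<lambda>t. t * norm z" UNIV])
  show "linear (\<lambda>t. t *\<^sub>R z)" "linear (\<lambda>t. t * norm z)"
    by (auto intro!: linearI simp: algebra_simps)
  show "u * norm z \<le> 1 * norm (u *\<^sub>R z)" for u :: real
    by (simp add: mult_right_mono)
next
  fix f :: "'v \<Rightarrow>\<^sub>L real"
  assume f: "\<And>u. u \<in> UNIV \<Longrightarrow> f (u *\<^sub>R z) = u * norm z" "norm f \<le> 1"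
  show thesis using that[OF _ f(2)] f(1)[of 1] by simp
qed auto

text \<open>With \<open>d\<close> a positive lower bound for the distance from \<open>v\<close> to
  \<open>S\<close>, the value \<open>t * d\<close> is prescribed at
  \<open>t *\<^sub>R v + s\<close>. Parametrising by pairs \<open>(t, s)\<close> leaves consistency
  to the norm estimate.\<close>

lemma annihilating_functional:
  fixes v :: "'v::real_normed_vector"
  assumes S: "subspace S" and v: "v \<notin> closure S"
  obtains f :: "'v \<Rightarrow>\<^sub>L real" where "\<And>s. s \<in> S \<Longrightarrow> f s = 0" "f v \<noteq> 0"
proof -
  obtain d where d: "d > 0" "\<And>s. s \<in> S \<Longrightarrow> d \<le> norm (v - s)"
    using v unfolding closure_approachable by (metis dist_commute dist_norm not_less)
  obtain f :: "'v \<Rightarrow>\<^sub>L real" where f: "\<And>u. u \<in> UNIV \<times> S \<Longrightarrow> f (fst u *\<^sub>R v + snd u) = fst u * d"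
  proof (rule hahn_banach_norm[of 1 "\<lambda>u. fst u *\<^sub>R v + snd u" "\<lambda>u. fst u * d" "UNIV \<times> S"])
    show "linear (\<lambda>u :: real \<times> 'v. fst u *\<^sub>R v + snd u)" "linear (\<lambda>u :: real \<times> 'v. fst u * d)"
      by (auto intro!: linearI simp: algebra_simps)
    show "subspace ((UNIV :: real set) \<times> S)" using S by (simp add: subspace_Times)
    fix u :: "real \<times> 'v" assume u: "u \<in> UNIV \<times> S"
    show "fst u * d \<le> 1 * norm (fst u *\<^sub>R v + snd u)"
    proof (cases "fst u = 0")
      case False
      have "- inverse (fst u) *\<^sub>R snd u \<in> S" using u S by (auto intro!: subspace_neg subspace_scale)
      then have "\<bar>fst u\<bar> * d \<le> \<bar>fst u\<bar> * norm (v - (- inverse (fst u) *\<^sub>R snd u))"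
        by (intro mult_left_mono d(2)) auto
      also have "\<dots> = norm (fst u *\<^sub>R v + snd u)"
        using False by (simp flip: norm_scaleR add: scaleR_add_right)
      finally show ?thesis using d(1) by (smt (verit) mult_right_mono)
    qed simp
  qed auto
  show thesis
  proof
    show "f s = 0" if "s \<in> S" for s using f[of "(0, s)"] that by simp
    show "f v \<noteq> 0" using f[of "(1, 0)"] subspace_0[OF S] d(1) by simp
  qed
qed

section \<open>Simons' inequality and density in the dual\<close>

lemma linear_blinfun: "linear (blinfun_apply f)"
  by (rule bounded_linear.linear[OF blinfun.bounded_linear_right])

text \<open>Induction on \<open>G\<close>. If some \<open>z0\<close> is killed by \<open>G\<close>
  but not by \<open>g\<close>, subtracting a multiple of \<open>g\<close> from \<open>f\<close>
  makes it vanish on the common kernel of \<open>G\<close>; otherwise \<open>g\<close> vanishes on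
  that kernel and adds no condition.\<close>

lemma kernel_span:
  fixes f :: "'v::real_normed_vector \<Rightarrow>\<^sub>L real"
  assumes "finite G" "\<And>z. (\<And>g. g \<in> G \<Longrightarrow> blinfun_apply g z = 0) \<Longrightarrow> f z = 0"
  shows "f \<in> span G"
  using assms
proof (induction G arbitrary: f rule: finite_induct)
  case empty
  then have "f = 0" by (intro blinfun_eqI) simp
  then show ?case by (simp add: span_zero)
next
  case (insert g G)
  show ?case
  proof (cases "\<exists>z. (\<forall>h\<in>G. blinfun_apply h z = 0) \<and> g z \<noteq> 0")
    case True
    then obtain z0 where z0: "\<And>h. h \<in> G \<Longrightarrow> blinfun_apply h z0 = 0" "g z0 \<noteq> 0" by blast
    have "f - (f z0 / g z0) *\<^sub>R g \<in> span G"
    proof (rule insert.IH)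
      fix z assume z: "\<And>h. h \<in> G \<Longrightarrow> blinfun_apply h z = 0"
      have "f (z - (g z / g z0) *\<^sub>R z0) = 0"
        by (rule insert.prems) (use z z0 in \<open>auto simp: blinfun.bilinear_simps\<close>)
      then show "(f - (f z0 / g z0) *\<^sub>R g) z = 0"
        by (simp add: blinfun.bilinear_simps mult.commute)
    qed
    then show ?thesis unfolding span_insert by blast
  next
    case False
    then have "f \<in> span G" using insert.prems by (intro insert.IH) blast
    then show ?thesis by (meson span_mono subsetD subset_insertI)
  qed
qed

text \<open>If no such vector existed, \<open>f\<close> would have norm at most \<open>s / 2\<close>
  on the common kernel. An extension \<open>F\<close> of this restriction with the same bound has
  \<open>f - F \<in> span G\<close>, which puts \<open>f\<close> within \<open>s / 2\<close> of the
  span.\<close>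

lemma helly:
  fixes f :: "'v::real_normed_vector \<Rightarrow>\<^sub>L real"
  assumes G: "finite G" and s: "s > 0" "\<And>g. g \<in> span G \<Longrightarrow> s \<le> norm (f - g)"
  obtains z where "norm z \<le> 1" "s / 2 \<le> f z" "\<And>g. g \<in> G \<Longrightarrow> blinfun_apply g z = 0"
proof (rule ccontr)
  assume "\<not> thesis"
  then have *: "\<not> (norm z \<le> 1 \<and> s / 2 \<le> f z \<and> (\<forall>g\<in>G. blinfun_apply g z = 0))" for z
    using that by blast
  define L where "L = {z. \<forall>g\<in>G. blinfun_apply g z = 0}"
  have "subspace L" unfolding L_def by (rule subspaceI) (auto simp: blinfun.bilinear_simps)
  moreover have "f z \<le> s / 2 * norm z" if "z \<in> L" for z
  proof (cases "z = 0")
    case False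
    have "\<not> s / 2 \<le> f (inverse (norm z) *\<^sub>R z)"
      using *[of "inverse (norm z) *\<^sub>R z"] that False by (auto simp: L_def blinfun.bilinear_simps)
    then show ?thesis using False by (simp add: blinfun.bilinear_simps field_simps)
  qed simp
  ultimately obtain F :: "'v \<Rightarrow>\<^sub>L real" where F: "\<And>z. z \<in> L \<Longrightarrow> F z = f z" "norm F \<le> s / 2"
    using hahn_banach_norm[of "s / 2" "\<lambda>z. z" "blinfun_apply f" L] s(1)
    by (auto simp: linear_ident linear_blinfun)
  have "f - F \<in> span G"
    by (rule kernel_span[OF G]) (use F(1) in \<open>auto simp: L_def blinfun.bilinear_simps\<close>)
  from s(2)[OF this] F(2) s(1) show False by simp
qed

text \<open>The point \<open>w\<close> is an infinite convex combination of points
  \<open>y n \<in> C n\<close>, each nearly minimising the norm after the earlier terms are fixed.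
  The rescaled remainders \<open>\<sigma> n\<close> lie in \<open>C n\<close>; comparing
  \<open>y n\<close> with \<open>\<sigma> n\<close> shows that a functional norming \<open>w\<close>
  loses at most \<open>d\<close> on passing from \<open>w\<close> to
  \<open>\<sigma> n\<close>.\<close>

lemma simons:
  fixes C :: "nat \<Rightarrow> 'e::banach set"
  assumes C: "decseq C" "\<And>n. closed (C n)" "\<And>n. convex (C n)" "\<And>n. C n \<noteq> {}"
    and bound: "\<And>x. x \<in> C 0 \<Longrightarrow> norm x \<le> 1" and d: "d > 0"
  obtains w where "w \<in> C 0"
    "\<And>(b :: 'e \<Rightarrow>\<^sub>L real) n. norm b \<le> 1 \<Longrightarrow> blinfun_apply b w = norm w \<Longrightarrow> \<exists>\<sigma>\<in>C n. norm w - d \<le> blinfun_apply b \<sigma>"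
proof -
  have mono: "C m \<subseteq> C n" if "n \<le> m" for m n using C(1) that by (rule decseqD)
  \<comment> \<open>The weight \<open>(1/2)^n\<close> is the total mass of the series from index
    \<open>n\<close> on, so that \<open>\<sigma> n\<close> later competes with value
    \<open>norm w\<close>; the term actually added has half this weight. The errors
    \<open>d * (1/4)^Suc n\<close>, multiplied by \<open>2^n\<close>, still sum to less than
    \<open>d\<close>.\<close>
  have "\<exists>y\<in>C n. \<forall>y'\<in>C n. norm (u + (1/2)^n *\<^sub>R y) \<le> norm (u + (1/2)^n *\<^sub>R y') + d * (1/4)^Suc n" for n u
  proof -
    let ?I = "(\<lambda>y. norm (u + (1/2)^n *\<^sub>R y)) ` C n"
    have "Inf ?I < Inf ?I + d * (1/4)^Suc n" using d by simp
    then obtain y where "y \<in> C n" "norm (u + (1/2)^n *\<^sub>R y) < Inf ?I + d * (1/4)^Suc n"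
      using cInf_lessD[of ?I "Inf ?I + d * (1/4)^Suc n"] C(4) by auto
    moreover have "Inf ?I \<le> norm (u + (1/2)^n *\<^sub>R y')" if "y' \<in> C n" for y'
      by (rule cINF_lower) (use that in \<open>auto intro!: bdd_belowI2[of _ 0]\<close>)
    ultimately show ?thesis by (intro bexI[of _ y] ballI) force+
  qed
  then obtain h where hC: "\<And>n u. h n u \<in> C n" and h: "\<And>n u y'. y' \<in> C n \<Longrightarrow>
      norm (u + (1/2)^n *\<^sub>R h n u) \<le> norm (u + (1/2)^n *\<^sub>R y') + d * (1/4)^Suc n"
    by metis
  define u where "u = rec_nat 0 (\<lambda>n v. v + (1/2)^Suc n *\<^sub>R h n v)"
  define y where "y n = h n (u n)" for n
  have u0: "u 0 = 0" and uS: "u (Suc n) = u n + (1/2)^Suc n *\<^sub>R y n" for n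
    by (simp_all add: u_def y_def)
  have yC: "y n \<in> C n" for n by (simp add: y_def hC)
  have y1: "norm (y n) \<le> 1" for n using yC[of n] mono[of 0 n] bound by auto
  have u_sum: "u n = (\<Sum>i<n. (1/2)^Suc i *\<^sub>R y i)" for n
    by (induction n) (simp_all add: u0 uS)
  have "summable (\<lambda>i. (1/2::real)^Suc i *\<^sub>R y i)"
  proof (rule summable_comparison_test')
    show "summable (\<lambda>i. (1/2::real)^Suc i)" by (simp add: summable_geometric)
    show "norm ((1/2::real)^Suc i *\<^sub>R y i) \<le> (1/2)^Suc i" for i
      using y1[of i] by (simp add: mult_left_le)
  qed
  then obtain w where w: "u \<longlonglongrightarrow> w"
    unfolding u_sum[abs_def] summable_def sums_def by blast
  define \<sigma> where "\<sigma> n = 2^n *\<^sub>R (w - u n)" for n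
  have tail: "2^n *\<^sub>R (u (n + m) - u n) + (1/2)^m *\<^sub>R c \<in> C n" if "c \<in> C (n + m)" for n m c
    using that
  proof (induction m arbitrary: c)
    case (Suc m)
    have c: "c \<in> C (n + m)" using Suc.prems mono[of "n + m" "n + Suc m"] by auto
    have half: "(1/2) *\<^sub>R y (n + m) + (1/2) *\<^sub>R c \<in> C (n + m)"
      using c yC by (intro convexD[OF C(3)]) auto
    have "2^n * (1/2)^Suc (n + m) = (1/2::real)^Suc m"
      by (simp add: power_add power_one_over)
    moreover have "u (n + Suc m) - u n = (u (n + m) - u n) + (1/2)^Suc (n + m) *\<^sub>R y (n + m)"
      by (simp add: uS)
    ultimately have "2^n *\<^sub>R (u (n + Suc m) - u n) = 2^n *\<^sub>R (u (n + m) - u n) + (1/2)^Suc m *\<^sub>R y (n + m)"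
      by (simp only: scaleR_add_right scaleR_scaleR)
    then show ?case
      using Suc.IH[of "(1/2) *\<^sub>R y (n + m) + (1/2) *\<^sub>R c", OF half]
      by (simp add: scaleR_add_right add.assoc)
  qed simp
  have \<sigma>C: "\<sigma> n \<in> C n" for n
  proof (rule closed_sequentially[OF C(2)])
    show "2^n *\<^sub>R (u (n + m) - u n) + (1/2)^m *\<^sub>R y (n + m) \<in> C n" for m
      using tail yC by blast
    have "(\<lambda>m. (1/2::real)^m *\<^sub>R y (n + m)) \<longlonglongrightarrow> 0"
    proof (rule Lim_null_comparison)
      show "\<forall>\<^sub>F m in sequentially. norm ((1/2::real)^m *\<^sub>R y (n + m)) \<le> (1/2)^m"
        using y1 by (simp add: mult_left_le)
      show "(\<lambda>m. (1/2::real)^m) \<longlonglongrightarrow> 0" by (rule LIMSEQ_realpow_zero) auto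
    qed
    moreover have "(\<lambda>m. u (n + m)) \<longlonglongrightarrow> w"
      using LIMSEQ_ignore_initial_segment[OF w, of n] by (simp add: add.commute)
    ultimately have "(\<lambda>m. 2^n *\<^sub>R (u (n + m) - u n) + (1/2)^m *\<^sub>R y (n + m)) \<longlonglongrightarrow> 2^n *\<^sub>R (w - u n) + 0"
      by (intro tendsto_intros)
    then show "(\<lambda>m. 2^n *\<^sub>R (u (n + m) - u n) + (1/2)^m *\<^sub>R y (n + m)) \<longlonglongrightarrow> \<sigma> n"
      by (simp add: \<sigma>_def)
  qed
  show thesis
  proof (rule that)
    show "w \<in> C 0" using \<sigma>C[of 0] by (simp add: \<sigma>_def u0)
    fix b :: "'e \<Rightarrow>\<^sub>L real" and n
    assume b: "norm b \<le> 1" "b w = norm w"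
    have b_le: "b x \<le> norm x" for x
      using norm_blinfun[of b x] b(1) mult_right_mono[OF b(1), of "norm x"] by simp
    \<comment> \<open>Near minimality of \<open>y k\<close> against the competitor
      \<open>\<sigma> k\<close>, whose vector is \<open>w\<close> itself, where the norm equals
      \<open>b w\<close>.\<close>
    have step: "b (w - u k) \<le> 2 * b (w - u (Suc k)) + d * (1/4)^Suc k" for k
    proof -
      have "b (u k + (1/2)^k *\<^sub>R y k) \<le> norm (u k + (1/2)^k *\<^sub>R \<sigma> k) + d * (1/4)^Suc k"
        using b_le h[of "\<sigma> k" k "u k", OF \<sigma>C] unfolding y_def by (rule order_trans)
      also have "u k + (1/2)^k *\<^sub>R \<sigma> k = w" by (simp add: \<sigma>_def power_divide)
      finally show ?thesis by (simp add: uS b(2) blinfun.bilinear_simps algebra_simps)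
    qed
    have "norm w - d * (1 - (1/2)^k) \<le> 2^k * b (w - u k)" for k
    proof (induction k)
      case 0
      then show ?case by (simp add: u0 b(2))
    next
      case (Suc k)
      have "2^k * b (w - u k) \<le> 2^k * (2 * b (w - u (Suc k)) + d * (1/4)^Suc k)"
        using step by (intro mult_left_mono) auto
      also have "\<dots> = 2^Suc k * b (w - u (Suc k)) + d * (1/2)^k / 4"
      proof -
        have "(1/4::real)^k = (1/2)^k * (1/2)^k" "2^k * (1/2::real)^k = 1"
          by (simp_all flip: power_mult_distrib)
        then have "2^k * (1/4)^Suc k = (1/2::real)^k / 4"
          by (simp add: algebra_simps)
        then show ?thesis by (simp add: distrib_left mult.left_commute)
      qed
      finally have "norm w - d * (1 - (1/2)^k) \<le> 2^Suc k * b (w - u (Suc k)) + d * (1/2)^k / 4"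
        using Suc by simp
      moreover have "d * (1 - (1/2)^k) + d * (1/2)^k / 4 \<le> d * (1 - (1/2)^Suc k)"
        using d by (simp add: algebra_simps)
      ultimately show ?case by simp
    qed
    from this[of n] have "norm w - d * (1 - (1/2)^n) \<le> b (\<sigma> n)"
      by (simp add: \<sigma>_def blinfun.scaleR_right)
    moreover have "d * (1 - (1/2)^n) \<le> d" using d by (intro mult_left_le) auto
    ultimately have "norm w - d \<le> b (\<sigma> n)" by linarith
    with \<sigma>C show "\<exists>\<sigma>\<in>C n. norm w - d \<le> b \<sigma>" by blast
  qed
qed

lemma finite_net_convex_hull:
  fixes S :: "'v::real_normed_vector set"
  assumes "finite S" "e > 0"
  obtains k where "finite k" "convex hull S \<subseteq> (\<Union>x\<in>k. ball x e)"
  using finite_imp_compact_convex_hull[OF assms(1)] assms(2) unfolding compact_eq_totally_bounded by blast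

text \<open>\<open>G x\<close> lists the functionals predicted from \<open>x\<close>, and
  \<open>bd\<close> allows a prediction at \<open>e\<close> from any set \<open>D\<close> whose
  closure contains \<open>e\<close>. The convex hull of a sequence is separable, so a countable
  \<open>D\<close> suffices and each stage has only finitely many functionals to annihilate.\<close>

theorem boundary_dense:
  fixes G :: "'e::banach \<Rightarrow> nat \<Rightarrow> ('e \<Rightarrow>\<^sub>L real)"
  assumes N: "subspace N" "\<And>x j. G x j \<in> N"
    and bd: "\<And>D e \<epsilon>. e \<in> closure D \<Longrightarrow> e \<noteq> 0 \<Longrightarrow> \<epsilon> > 0 \<Longrightarrow>
      \<exists>b. norm b \<le> 1 \<and> blinfun_apply b e = norm e \<and> (\<exists>c\<in>span (\<Union>d\<in>D. range (G d)). norm (b - c) \<le> \<epsilon>)"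
  shows "f \<in> closure N"
proof (rule ccontr)
  assume "f \<notin> closure N"
  then obtain s where s: "s > 0" "\<And>g. g \<in> N \<Longrightarrow> s \<le> norm (f - g)"
    unfolding closure_approachable by (metis dist_commute dist_norm not_less)
  \<comment> \<open>Finite nets are fixed by choice beforehand, so that the recursive construction
    of the sequence can refer to them.\<close>
  define net where "net S m = (SOME k. finite k \<and> convex hull S \<subseteq> (\<Union>x\<in>k. ball x (1 / real (Suc m))))"
    for S :: "'e set" and m
  have net: "finite (net S m)" "convex hull S \<subseteq> (\<Union>x\<in>net S m. ball x (1 / real (Suc m)))"
    if "finite S" for S :: "'e set" and m
  proof -
    have "\<exists>k. finite k \<and> convex hull S \<subseteq> (\<Union>x\<in>k. ball x (1 / real (Suc m)))"
      by (rule finite_net_convex_hull[OF that, of "1 / real (Suc m)"]) auto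
    from someI_ex[OF this] show "finite (net S m)" "convex hull S \<subseteq> (\<Union>x\<in>net S m. ball x (1 / real (Suc m)))"
      unfolding net_def by auto
  qed
  \<comment> \<open>The new vector is killed by the first \<open>n + 1\<close> functionals predicted
    from each point of the nets of the initial segments of length at most \<open>n\<close>. Only
    terms of index below \<open>n\<close> enter, as the recursive choice requires.\<close>
  define P where "P z n r \<longleftrightarrow> norm r \<le> 1 \<and> s / 2 \<le> f r \<and>
      (\<forall>m\<le>n. \<forall>a\<in>net (z ` {..<m}) m. \<forall>j\<le>n. G a j r = 0)" for z :: "nat \<Rightarrow> 'e" and n r
  have "\<exists>z. \<forall>n. P z n (z n)"
  proof (rule dependent_wellorder_choice)
    fix r x and z z' :: "nat \<Rightarrow> 'e"
    assume "\<And>y. y < x \<Longrightarrow> z y = z' y"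
    then have "z ` {..<m} = z' ` {..<m}" if "m \<le> x" for m using that by (intro image_cong) auto
    then show "P z x r = P z' x r" by (simp add: P_def)
  next
    fix n and z :: "nat \<Rightarrow> 'e"
    let ?A = "(\<Union>m\<le>n. \<Union>a\<in>net (z ` {..<m}) m. G a ` {..n})"
    have fin: "finite ?A" using net(1) by auto
    have "span ?A \<subseteq> N" by (rule span_minimal) (use N in auto)
    then have *: "\<And>g. g \<in> span ?A \<Longrightarrow> s \<le> norm (f - g)" using s(2) by auto
    obtain r where "norm r \<le> 1" "s / 2 \<le> f r" "\<And>g. g \<in> ?A \<Longrightarrow> blinfun_apply g r = 0"
      using helly[OF fin s(1) *] by blast
    then show "\<exists>r. P z n r" unfolding P_def by (intro exI[of _ r]) force
  qed
  then obtain z where z: "\<And>n. P z n (z n)" by blast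
  define D where "D = (\<Union>m. net (z ` {..<m}) m)"
  define C where "C n = closure (convex hull (z ` {n..}))" for n
  have C_bound: "norm x \<le> 1" "s / 2 \<le> f x" if "x \<in> C n" for x n
  proof -
    have "closed {x. norm x \<le> 1 \<and> s / 2 \<le> f x}"
      by (intro closed_Collect_conj closed_Collect_le continuous_intros)
    moreover have "convex {x. s / 2 \<le> f x}"
      using convex_linear_vimage[of "blinfun_apply f" "{s/2..}"]
      by (simp add: vimage_def linear_blinfun)
    then have "convex (cball 0 1 \<inter> {x. s / 2 \<le> f x})" by (intro convex_Int convex_cball)
    then have "convex {x. norm x \<le> 1 \<and> s / 2 \<le> f x}" by (simp add: cball_def Int_def)
    ultimately have "C n \<subseteq> {x. norm x \<le> 1 \<and> s / 2 \<le> f x}"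
      unfolding C_def using z by (intro closure_minimal hull_minimal) (auto simp: P_def)
    with that show "norm x \<le> 1" "s / 2 \<le> f x" by auto
  qed
  have "convex hull (z ` {0..}) \<subseteq> closure D"
  proof
    fix x assume "x \<in> convex hull (z ` {0..})"
    then obtain F v where F: "finite F" "F \<subseteq> range z" "\<forall>x\<in>F. 0 \<le> v x" "sum v F = 1" "(\<Sum>y\<in>F. v y *\<^sub>R y) = x"
      unfolding convex_hull_explicit by auto
    then have xF: "x \<in> convex hull F" by (auto simp: convex_hull_finite)
    obtain I where I: "finite I" "F = z ` I" using finite_subset_image[OF F(1,2)] by blast
    obtain M where M: "\<And>i. i \<in> I \<Longrightarrow> i < M" using I(1) unfolding finite_nat_set_iff_bounded by blast
    show "x \<in> closure D"
      unfolding closure_approachable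
    proof (intro allI impI)
      fix e :: real assume "e > 0"
      then obtain m where m: "1 / real (Suc m) < e" using nat_approx_posE by blast
      define K where "K = max M m"
      have "F \<subseteq> z ` {..<K}" using I(2) M by (force simp: K_def)
      then have "x \<in> convex hull (z ` {..<K})" using xF hull_mono by blast
      then obtain d where d: "d \<in> net (z ` {..<K}) K" "dist d x < 1 / real (Suc K)"
        using net(2)[of "z ` {..<K}" K] by auto
      have "1 / real (Suc K) \<le> 1 / real (Suc m)" by (intro divide_left_mono) (auto simp: K_def)
      with d m show "\<exists>d\<in>D. dist d x < e" unfolding D_def by force
    qed
  qed
  then have C0: "C 0 \<subseteq> closure D" unfolding C_def by (intro closure_minimal) auto
  \<comment> \<open>On \<open>C 0\<close> the functional \<open>f\<close> is at least
    \<open>s / 2\<close>, so \<open>r\<close> bounds the norm from below there.\<close>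
  define r where "r = s / (2 * norm f)"
  have f0: "norm f > 0" using s(2)[of 0] s(1) subspace_0[OF N(1)] by auto
  have r0: "r > 0" using s(1) f0 by (simp add: r_def)
  obtain w where w: "w \<in> C 0" "\<And>(b :: 'e \<Rightarrow>\<^sub>L real) n. norm b \<le> 1 \<Longrightarrow> blinfun_apply b w = norm w \<Longrightarrow> \<exists>\<sigma>\<in>C n. norm w - r/4 \<le> blinfun_apply b \<sigma>"
  proof (rule simons[of C "r/4"])
    show "decseq C" unfolding decseq_def C_def by (auto intro!: closure_mono hull_mono image_mono)
    show "norm x \<le> 1" if "x \<in> C 0" for x using that by (rule C_bound)
  qed (use r0 in \<open>auto simp: C_def convex_closure\<close>)
  have "s / 2 \<le> norm f * norm w" using C_bound(2)[OF w(1)] norm_blinfun[of f w] by simp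
  then have rw: "r \<le> norm w" using f0 by (simp add: r_def field_simps)
  then have "w \<noteq> 0" using r0 by auto
  moreover have "w \<in> closure D" using C0 w(1) by blast
  ultimately obtain b c where b: "norm b \<le> 1" "blinfun_apply b w = norm w"
      and c: "c \<in> span (\<Union>d\<in>D. range (G d))" "norm (b - c) \<le> r / 4"
    using bd[of w D "r/4"] r0 by auto
  \<comment> \<open>A generator \<open>G d j\<close> with \<open>d\<close> in the net of stage
    \<open>m\<close> is killed by \<open>z k\<close> once \<open>k\<close> is at least
    \<open>m\<close> and \<open>j\<close>, and \<open>c\<close> combines finitely many
    generators.\<close>
  have "\<exists>n. \<forall>k\<ge>n. blinfun_apply c (z k) = 0" using c(1)
  proof (induction rule: span_induct_alt)
    case base
    then show ?case by simp
  next
    case (step a x y)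
    then obtain m d j where x: "d \<in> net (z ` {..<m}) m" "x = G d j" by (auto simp: D_def)
    obtain n where n: "\<And>k. k \<ge> n \<Longrightarrow> blinfun_apply y (z k) = 0" using step by auto
    have "blinfun_apply (a *\<^sub>R x + y) (z k) = 0" if "k \<ge> Max {m, j, n}" for k
      using z[of k] that x n[of k] by (auto simp: P_def blinfun.bilinear_simps)
    then show ?case by blast
  qed
  then obtain n where n: "\<And>k. k \<ge> n \<Longrightarrow> blinfun_apply c (z k) = 0" by blast
  have c0: "blinfun_apply c x = 0" if "x \<in> C n" for x
  proof -
    have "subspace {x. c x = 0}" by (rule subspaceI) (auto simp: blinfun.bilinear_simps)
    then have "convex {x. c x = 0}" by (rule subspace_imp_convex)
    moreover have "closed {x. c x = 0}" by (intro closed_Collect_eq continuous_intros)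
    ultimately have "C n \<subseteq> {x. c x = 0}"
      unfolding C_def using n by (intro closure_minimal hull_minimal) auto
    with that show ?thesis by auto
  qed
  obtain \<sigma> where \<sigma>: "\<sigma> \<in> C n" "norm w - r / 4 \<le> b \<sigma>" using w(2)[OF b] by blast
  \<comment> \<open>On \<open>C n\<close> the functional \<open>b\<close> agrees with
    \<open>b - c\<close>, so \<open>b \<sigma>\<close> is at most \<open>r / 4\<close>, whereas
    Simons' inequality makes it at least \<open>norm w - r / 4\<close>, hence at least
    \<open>3 * r / 4\<close>.\<close>
  have "b \<sigma> \<le> norm (b - c) * norm \<sigma>"
    using norm_blinfun[of "b - c" \<sigma>] c0[OF \<sigma>(1)] by (simp add: blinfun.bilinear_simps)
  also have "\<dots> \<le> r / 4 * 1"
    using c(2) C_bound(1)[OF \<sigma>(1)] r0 by (intro mult_mono) auto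
  finally show False using \<sigma>(2) rw r0 by simp
qed

section \<open>Strong subdifferentiability\<close>

lemma blinfun_le_norm:
  fixes f :: "'v::real_normed_vector \<Rightarrow>\<^sub>L real"
  assumes "norm f \<le> 1"
  shows "f x \<le> norm x"
  using norm_blinfun[of f x] mult_right_mono[OF assms, of "norm x"] by simp

text \<open>The sublinear function \<open>\<tau>\<close> is the one-sided derivative of the norm at \<open>z\<close>. Uniformity of the limit gives
  \<open>f \<le> \<tau> + \<epsilon> norm\<close>, and Hahn-Banach along the diagonal splits \<open>f\<close> accordingly.\<close>

lemma ssd_close_to_face:
  fixes z :: "'z::real_normed_vector"
  assumes ssd: "strongly_subdifferentiable TYPE('z)" and z: "norm z = 1" and \<epsilon>: "\<epsilon> > 0"
  obtains \<delta> where "\<delta> > 0"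
    "\<And>f :: 'z \<Rightarrow>\<^sub>L real. norm f \<le> 1 \<Longrightarrow> 1 - \<delta> < blinfun_apply f z \<Longrightarrow>
      \<exists>g :: 'z \<Rightarrow>\<^sub>L real. norm g \<le> 1 \<and> blinfun_apply g z = 1 \<and> norm (f - g) \<le> \<epsilon>"
proof -
  define D where "D t h = (norm (z + t *\<^sub>R h) - 1) / t" for t :: real and h
  obtain l where "uniform_limit (sphere 0 1) (\<lambda>t h. (norm (z + t *\<^sub>R h) - norm z) / t) l (at_right 0)"
    using ssd z unfolding strongly_subdifferentiable_def by blast
  then have l: "uniform_limit (sphere 0 1) D l (at_right 0)"
    by (simp only: z D_def[abs_def])
  \<comment> \<open>The limit is given on the unit sphere only; this is its positively homogeneous
    extension, with value 0 at 0.\<close>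
  define \<tau> where "\<tau> h = norm h * l (inverse (norm h) *\<^sub>R h)" for h
  have lim: "((\<lambda>t. D t h) \<longlongrightarrow> \<tau> h) (at_right 0)" for h
  proof (cases "h = 0")
    case True
    then show ?thesis by (simp add: D_def \<tau>_def z)
  next
    case False
    let ?h = "inverse (norm h) *\<^sub>R h"
    have "((\<lambda>t. D t ?h) \<longlongrightarrow> l ?h) (at_right 0)"
      by (rule tendsto_uniform_limitI[OF l]) (use False in simp)
    moreover have "filterlim (\<lambda>t. norm h * t) (at_right 0) (at_right 0)"
      by (rule filterlim_times_pos[OF filterlim_ident]) (use False in auto)
    ultimately have "((\<lambda>t. norm h * D (norm h * t) ?h) \<longlongrightarrow> norm h * l ?h) (at_right 0)"
      by (intro tendsto_intros) (rule filterlim_compose)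
    moreover have "norm h * D (norm h * t) ?h = D t h" for t
    proof -
      have "(norm h * t) *\<^sub>R ?h = t *\<^sub>R h" using False by (simp add: field_simps)
      then show ?thesis using False by (simp only: D_def) simp
    qed
    ultimately show ?thesis by (simp add: \<tau>_def)
  qed
  have ev: "\<forall>\<^sub>F t in at_right (0::real). 0 < t" by (rule eventually_at_right_less)
  have "sublinear \<tau>"
  proof (rule sublinearI)
    fix h k
    \<comment> \<open>Subadditivity compares the quotient at \<open>h + k\<close> with step
      \<open>t\<close> to those at \<open>h\<close> and \<open>k\<close> with step
      \<open>2 * t\<close>, since \<open>z + t *\<^sub>R (h + k)\<close> is the midpoint of the two
      displaced points.\<close>
    have lim2: "((\<lambda>t. D (2 * t) h) \<longlongrightarrow> \<tau> h) (at_right 0)" for h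
      by (rule filterlim_compose[OF lim]) (rule filterlim_times_pos[OF filterlim_ident], auto)
    have "\<forall>\<^sub>F t in at_right 0. D t (h + k) \<le> D (2 * t) h + D (2 * t) k"
      using ev
    proof eventually_elim
      case (elim t)
      have "2 *\<^sub>R (z + t *\<^sub>R (h + k)) = (z + (2 * t) *\<^sub>R h) + (z + (2 * t) *\<^sub>R k)"
        by (simp add: algebra_simps scaleR_2)
      then have "2 * norm (z + t *\<^sub>R (h + k)) \<le> norm (z + (2 * t) *\<^sub>R h) + norm (z + (2 * t) *\<^sub>R k)"
        by (metis norm_scaleR norm_triangle_ineq abs_numeral)
      then have "D t (h + k) \<le> ((norm (z + (2 * t) *\<^sub>R h) + norm (z + (2 * t) *\<^sub>R k)) / 2 - 1) / t"
        unfolding D_def using elim by (intro divide_right_mono) auto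
      also have "\<dots> = D (2 * t) h + D (2 * t) k"
        unfolding D_def by (simp add: diff_divide_distrib add_divide_distrib)
      finally show ?case .
    qed
    then show "\<tau> (h + k) \<le> \<tau> h + \<tau> k"
      by (rule tendsto_le[OF trivial_limit_at_right_real tendsto_add[OF lim2 lim2] lim])
  next
    fix c :: real and h :: 'z assume c: "c > 0"
    then have "inverse (norm (c *\<^sub>R h)) * c = inverse (norm h)" by simp
    then have "\<tau> (c *\<^sub>R h) = norm (c *\<^sub>R h) * l (inverse (norm h) *\<^sub>R h)"
      unfolding \<tau>_def scaleR_scaleR by (simp only:)
    with c show "\<tau> (c *\<^sub>R h) \<le> c * \<tau> h" by (simp add: \<tau>_def[of h])
  qed (simp add: \<tau>_def)
  have \<tau>_le: "\<tau> h \<le> norm h" for h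
  proof (rule tendsto_le[OF trivial_limit_at_right_real tendsto_const lim])
    show "\<forall>\<^sub>F t in at_right 0. D t h \<le> norm h"
      using ev
    proof eventually_elim
      case (elim t)
      then show ?case using norm_triangle_ineq[of z "t *\<^sub>R h"] z by (simp add: D_def field_simps)
    qed
  qed
  \<comment> \<open>This forces a functional below \<open>\<tau>\<close> of norm at most 1 to take
    exactly the value 1 at \<open>z\<close>.\<close>
  have \<tau>_z: "\<tau> (- z) \<le> - 1"
  proof (rule tendsto_le[OF trivial_limit_at_right_real tendsto_const lim])
    have "\<forall>\<^sub>F t in at_right (0::real). t \<in> {0<..<1}" by (rule eventually_at_right_real) simp
    then show "\<forall>\<^sub>F t in at_right 0. D t (- z) \<le> - 1"
    proof eventually_elim
      case (elim t)
      have "z + t *\<^sub>R - z = (1 - t) *\<^sub>R z" by (simp add: algebra_simps)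
      then have "D t (- z) = (norm ((1 - t) *\<^sub>R z) - 1) / t" by (simp only: D_def)
      also have "\<dots> = - 1" using elim z by simp
      finally show ?case by simp
    qed
  qed
  from uniform_limitD[OF l, of "\<epsilon> / 4"] \<epsilon>
  have "\<forall>\<^sub>F t in at_right 0. \<forall>h\<in>sphere 0 1. dist (D t h) (l h) < \<epsilon> / 4" by simp
  with ev have "\<forall>\<^sub>F t in at_right 0. 0 < t \<and> (\<forall>h\<in>sphere 0 1. dist (D t h) (l h) < \<epsilon> / 4)"
    by eventually_elim simp
  from eventually_happens'[OF trivial_limit_at_right_real this]
  obtain t where t: "t > 0" "\<And>h. norm h = 1 \<Longrightarrow> dist (D t h) (l h) < \<epsilon> / 4"
    by auto
  show thesis
  proof (rule that)
    \<comment> \<open>This is \<open>\<delta>\<close>: the defect of \<open>f\<close> at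
      \<open>z\<close>, divided by the step \<open>t\<close>, costs \<open>\<epsilon> / 4\<close>,
      and replacing the quotient at \<open>t\<close> by its limit costs another
      \<open>\<epsilon> / 4\<close>, uniformly on the sphere.\<close>
    show "t * (\<epsilon> / 4) > 0" using t \<epsilon> by simp
    fix f :: "'z \<Rightarrow>\<^sub>L real"
    assume f: "norm f \<le> 1" "1 - t * (\<epsilon> / 4) < f z"
    have unit: "f h \<le> l h + \<epsilon>" if h: "norm h = 1" for h
    proof -
      have "f z + t * f h \<le> norm (z + t *\<^sub>R h)"
        using blinfun_le_norm[OF f(1), of "z + t *\<^sub>R h"] by (simp add: blinfun.bilinear_simps)
      also have "\<dots> = 1 + t * D t h" using t(1) by (simp add: D_def)
      also have "\<dots> \<le> 1 + t * (l h + \<epsilon> / 4)"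
        using abs_le_D1[OF less_imp_le[OF t(2)[OF h, unfolded dist_real_def]]] t(1)
        by (intro add_left_mono mult_left_mono) linarith+
      finally have "t * f h < t * (l h + \<epsilon> / 4 + \<epsilon> / 4)" using f(2) by (simp add: distrib_left)
      then show ?thesis using t(1) \<epsilon> by simp
    qed
    \<comment> \<open>A linear \<open>F\<close> below \<open>p\<close> that equals \<open>f\<close>
      on the diagonal splits as \<open>f h = F (h, 0) + F (0, h)\<close>, the first summand below
      \<open>\<tau>\<close> and the second below \<open>\<epsilon> * norm h\<close>.\<close>
    define p where "p v = \<tau> (fst v) + \<epsilon> * norm (snd v)" for v :: "'z \<times> 'z"
    have "f h \<le> \<tau> h + \<epsilon> * norm h" for h
    proof (cases "h = 0")
      case False
      then have "norm h * f (inverse (norm h) *\<^sub>R h) \<le> norm h * (l (inverse (norm h) *\<^sub>R h) + \<epsilon>)"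
        by (intro mult_left_mono unit) auto
      moreover have "norm h * f (inverse (norm h) *\<^sub>R h) = f h"
        using False by (simp add: blinfun.scaleR_right)
      ultimately show ?thesis by (simp add: \<tau>_def distrib_left mult.commute)
    qed (simp add: \<tau>_def)
    then have le: "f h \<le> p (h, h)" for h by (simp add: p_def)
    note sl = sublinearD[OF \<open>sublinear \<tau>\<close>] sublinearD[OF sublinear_norm, of \<epsilon>]
    have p: "sublinear p"
      unfolding p_def
    proof (rule sublinearI)
      fix x y :: "'z \<times> 'z"
      show "\<tau> (fst (x + y)) + \<epsilon> * norm (snd (x + y)) \<le> \<tau> (fst x) + \<epsilon> * norm (snd x) + (\<tau> (fst y) + \<epsilon> * norm (snd y))"
        using sl(1)[of "fst x" "fst y"] sl(5)[of "snd x" "snd y"] \<epsilon> by simp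
    next
      fix c :: real and x :: "'z \<times> 'z" assume "c > 0"
      then show "\<tau> (fst (c *\<^sub>R x)) + \<epsilon> * norm (snd (c *\<^sub>R x)) \<le> c * (\<tau> (fst x) + \<epsilon> * norm (snd x))"
        using sl(2)[of c "fst x"] by (simp add: algebra_simps)
    qed (simp add: sl(3))
    have diag: "linear (\<lambda>h :: 'z. (h, h))" by (rule linearI) simp_all
    have f_lin: "linear (blinfun_apply f)" by (rule linear_blinfun)
    obtain F where F: "linear F" "\<And>h. F (h, h) = f h" "\<And>v. F v \<le> p v"
      by (rule hahn_banach[OF p diag f_lin subspace_UNIV]) (use le in auto)
    have F_fst: "linear (\<lambda>h. F (h, 0))"
      by (rule linear_compose[OF _ F(1), unfolded o_def]) (rule linearI, auto)
    have "F (h, 0) \<le> 1 * norm h" for h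
      using F(3)[of "(h, 0)"] \<tau>_le[of h] by (simp add: p_def)
    then obtain g :: "'z \<Rightarrow>\<^sub>L real" where g: "blinfun_apply g = (\<lambda>h. F (h, 0))" "norm g \<le> 1"
      by (rule linear_bounded_blinfun[OF F_fst]) auto
    have "g (- z) \<le> - 1" using F(3)[of "(- z, 0)"] \<tau>_z by (simp add: g p_def)
    then have "g z = 1" using blinfun_le_norm[OF g(2), of z] z by (simp add: blinfun.minus_right)
    moreover have diff: "(f - g) h \<le> \<epsilon> * norm h" for h
    proof -
      have "f h = F (h, 0) + F (0, h)"
        using linear_add[OF F(1), of "(h, 0)" "(0, h)"] F(2) by simp
      then show ?thesis using F(3)[of "(0, h)"] by (simp add: p_def g sl(3) blinfun.bilinear_simps)
    qed
    have "norm (f - g) \<le> \<epsilon>"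
    proof (rule norm_blinfun_bound)
      show "norm ((f - g) h) \<le> \<epsilon> * norm h" for h
        using diff[of h] diff[of "- h"] by (simp add: blinfun.minus_right abs_le_iff)
    qed (use \<epsilon> in simp)
    ultimately show "\<exists>g :: 'z \<Rightarrow>\<^sub>L real. norm g \<le> 1 \<and> blinfun_apply g z = 1 \<and> norm (f - g) \<le> \<epsilon>" using g(2) by blast
  qed
qed

text \<open>The prediction from \<open>z\<close> is a sequence \<open>G z j\<close> in
  \<open>N\<close> norming \<open>z\<close> up to \<open>1 / real (Suc j)\<close>. For
  \<open>d\<close> near \<open>e\<close> and large \<open>j\<close>, \<open>G d j\<close> also
  almost norms \<open>e\<close>, and strong subdifferentiability moves it slightly to a functional
  norming \<open>e\<close> exactly.\<close>

theorem ssd_norming_dense: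
  fixes N :: "('z::banach \<Rightarrow>\<^sub>L real) set"
  assumes ssd: "strongly_subdifferentiable TYPE('z)" and N: "subspace N"
    and norming: "\<And>z e. e > 0 \<Longrightarrow> \<exists>f\<in>N. norm f \<le> 1 \<and> norm z - e \<le> blinfun_apply f z"
  shows "f \<in> closure N"
proof -
  have "\<forall>z j. \<exists>f\<in>N. norm f \<le> 1 \<and> norm z - 1 / real (Suc j) \<le> blinfun_apply f z"
    by (intro allI norming) simp
  then obtain G where G: "\<And>z j. G z j \<in> N" "\<And>z j. norm (G z j) \<le> 1"
      "\<And>z j. norm z - 1 / real (Suc j) \<le> blinfun_apply (G z j) z" by metis
  show ?thesis
  proof (rule boundary_dense[OF N G(1)])
    fix D and e :: 'z and \<epsilon> :: real
    assume e: "e \<in> closure D" "e \<noteq> 0" "\<epsilon> > 0"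
    let ?z = "inverse (norm e) *\<^sub>R e"
    have "norm ?z = 1" using e by simp
    then obtain \<delta> where \<delta>: "\<delta> > 0"
      "\<And>f :: 'z \<Rightarrow>\<^sub>L real. norm f \<le> 1 \<Longrightarrow> 1 - \<delta> < blinfun_apply f ?z \<Longrightarrow>
        \<exists>g :: 'z \<Rightarrow>\<^sub>L real. norm g \<le> 1 \<and> blinfun_apply g ?z = 1 \<and> norm (f - g) \<le> \<epsilon>"
      using ssd_close_to_face[OF ssd _ e(3)] by blast
    \<comment> \<open>Three errors below \<open>\<eta>\<close> add up: moving the functional from
      \<open>d\<close> to \<open>e\<close>, comparing the two norms, and the defect of
      \<open>G d j\<close> at \<open>d\<close>. The fourth \<open>\<eta>\<close> leaves strict
      room.\<close>
    define \<eta> where "\<eta> = \<delta> * norm e / 4"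
    have \<eta>: "\<eta> > 0" using \<delta>(1) e by (simp add: \<eta>_def)
    obtain d where d: "d \<in> D" "dist d e < \<eta>" using e(1) \<eta> unfolding closure_approachable by blast
    obtain j where j: "1 / real (Suc j) < \<eta>" using \<eta> nat_approx_posE by blast
    let ?f = "G d j"
    have "?f d - ?f e \<le> norm (d - e)"
      using blinfun_le_norm[OF G(2), of d j "d - e"] by (simp add: blinfun.diff_right)
    moreover have "norm e - norm d \<le> norm (d - e)" by (metis norm_minus_commute norm_triangle_ineq2)
    moreover have "norm (d - e) < \<eta>" using d(2) by (simp add: dist_norm)
    ultimately have "norm e - 3 * \<eta> < ?f e" using G(3)[of d j] j by simp
    then have "norm e * (1 - \<delta>) < ?f e" using \<eta> by (simp add: \<eta>_def algebra_simps)
    then have "1 - \<delta> < ?f ?z" using e by (simp add: blinfun.scaleR_right field_simps)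
    then obtain g :: "'z \<Rightarrow>\<^sub>L real" where g: "norm g \<le> 1" "g ?z = 1" "norm (?f - g) \<le> \<epsilon>"
      using \<delta>(2)[OF G(2)] by blast
    have "g e = norm e" using g(2) e by (simp add: blinfun.scaleR_right field_simps)
    moreover have "?f \<in> span (\<Union>d\<in>D. range (G d))" using d(1) by (intro span_base) auto
    ultimately show "\<exists>b. norm b \<le> 1 \<and> blinfun_apply b e = norm e \<and>
        (\<exists>c\<in>span (\<Union>d\<in>D. range (G d)). norm (b - c) \<le> \<epsilon>)"
      using g(1) g(3)[unfolded norm_minus_commute[of ?f]] by blast
  qed
qed

section \<open>Functionals on the projective tensor product\<close>

lemma norm_bidual_embedding: "norm (bidual_embedding v) = norm v"
proof (rule order_antisym)
  show "norm (bidual_embedding v) \<le> norm v"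
    by (rule norm_blinfun_bound) (simp_all add: bidual_embedding.rep_eq norm_blinfun mult.commute[of "norm v"] del: real_norm_def)
  obtain f :: "'a \<Rightarrow>\<^sub>L real" where f: "f v = norm v" "norm f \<le> 1" by (rule norming_functional)
  have "norm v \<le> norm (bidual_embedding v) * norm f"
    using norm_blinfun[of "bidual_embedding v" f] f(1) by (simp add: bidual_embedding.rep_eq)
  also have "\<dots> \<le> norm (bidual_embedding v)" using f(2) by (intro mult_left_le) auto
  finally show "norm v \<le> norm (bidual_embedding v)" .
qed

lemma bounded_linear_bidual_embedding: "bounded_linear bidual_embedding"
  by (rule bounded_linear_intro[of _ 1])
     (auto intro!: blinfun_eqI simp: bidual_embedding.rep_eq blinfun.bilinear_simps norm_bidual_embedding)

text \<open>The uniform norm bound carries convergence over to the closure. The lemma serves twice: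
  for functionals tested on elementary tensors, and for embedded elementary tensors tested on
  rank-one functionals.\<close>

lemma tendsto_closure_span:
  fixes \<phi> :: "'s \<Rightarrow> ('v::real_normed_vector \<Rightarrow>\<^sub>L real)"
  assumes bd: "\<forall>\<^sub>F s in F. norm (\<phi> s) \<le> 1" and \<psi>: "norm \<psi> \<le> 1"
    and lim: "\<And>v. v \<in> S \<Longrightarrow> ((\<lambda>s. \<phi> s v) \<longlongrightarrow> blinfun_apply \<psi> v) F"
    and v: "v \<in> closure (span S)"
  shows "((\<lambda>s. \<phi> s v) \<longlongrightarrow> \<psi> v) F"
proof (rule tendstoI)
  fix e :: real assume e: "e > 0"
  then obtain w where w: "w \<in> span S" "norm (w - v) < e / 3"
    using v unfolding closure_approachable dist_norm by (metis zero_less_divide_iff zero_less_numeral)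
  have "((\<lambda>s. \<phi> s w) \<longlongrightarrow> \<psi> w) F"
    using w(1)
  proof (induction rule: span_induct_alt)
    case (step c x y)
    then show ?case by (auto simp: blinfun.bilinear_simps intro!: tendsto_intros lim)
  qed simp
  then have "\<forall>\<^sub>F s in F. dist (\<phi> s w) (\<psi> w) < e / 3" using e by (intro tendstoD) auto
  with bd show "\<forall>\<^sub>F s in F. dist (\<phi> s v) (\<psi> v) < e"
  proof eventually_elim
    case (elim s)
    have "\<bar>\<phi> s w - \<phi> s v\<bar> \<le> norm (w - v)" "\<bar>\<psi> w - \<psi> v\<bar> \<le> norm (w - v)"
      using blinfun_le_norm[OF elim(1), of "w - v"] blinfun_le_norm[OF elim(1), of "v - w"]
        blinfun_le_norm[OF \<psi>, of "w - v"] blinfun_le_norm[OF \<psi>, of "v - w"]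
      by (auto simp: blinfun.diff_right norm_minus_commute[of v] abs_le_iff)
    with elim(2) w(2) show ?case unfolding dist_real_def by linarith
  qed
qed

text \<open>Continuity of the coordinates is the point. For a basis vector \<open>b\<close>, its
  image in the bidual is not in the span of the images of the others, so \<open>kernel_span\<close>,
  applied in the bidual, gives a bounded functional killing the others but not
  \<open>b\<close>.\<close>

lemma finite_span_coordinates:
  fixes B :: "'v::real_normed_vector set"
  assumes "finite B"
  obtains C and f :: "'v \<Rightarrow> 'v \<Rightarrow>\<^sub>L real"
  where "finite C" "\<And>v. v \<in> span B \<Longrightarrow> v = (\<Sum>b\<in>C. f b v *\<^sub>R b)"
proof -
  obtain C where C: "C \<subseteq> B" "independent C" "B \<subseteq> span C"
    using maximal_independent_subset[of B] by blast
  have fin: "finite C" using C(1) assms finite_subset by blast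
  have "\<exists>g :: 'v \<Rightarrow>\<^sub>L real. blinfun_apply g b = 1 \<and> (\<forall>c\<in>C - {b}. blinfun_apply g c = 0)" if b: "b \<in> C" for b
  proof -
    have "bidual_embedding b \<notin> span (bidual_embedding ` (C - {b}))"
    proof
      assume "bidual_embedding b \<in> span (bidual_embedding ` (C - {b}))"
      then obtain v where v: "v \<in> span (C - {b})" "bidual_embedding b = bidual_embedding v"
        unfolding linear_span_image[OF bounded_linear.linear[OF bounded_linear_bidual_embedding]] by blast
      have "norm (b - v) = 0"
        using v(2) norm_bidual_embedding[of "b - v"]
        by (simp add: linear_diff[OF bounded_linear.linear[OF bounded_linear_bidual_embedding]])
      with v(1) b C(2) show False unfolding dependent_def by auto
    qed
    moreover have "bidual_embedding b \<in> span (bidual_embedding ` (C - {b}))"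
      if "\<forall>g :: 'v \<Rightarrow>\<^sub>L real. (\<forall>c\<in>C - {b}. blinfun_apply g c = 0) \<longrightarrow> blinfun_apply g b = 0"
    proof (rule kernel_span)
      fix g :: "'v \<Rightarrow>\<^sub>L real"
      assume z: "\<And>h. h \<in> bidual_embedding ` (C - {b}) \<Longrightarrow> blinfun_apply h g = 0"
      have "\<forall>c\<in>C - {b}. blinfun_apply g c = 0"
        using z[OF imageI] by (simp add: bidual_embedding.rep_eq)
      with that have "g b = 0" by blast
      then show "bidual_embedding b g = 0" by (simp add: bidual_embedding.rep_eq)
    qed (use fin in simp)
    ultimately have "\<not> (\<forall>g :: 'v \<Rightarrow>\<^sub>L real. (\<forall>c\<in>C - {b}. blinfun_apply g c = 0) \<longrightarrow> blinfun_apply g b = 0)"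
      by blast
    then obtain g :: "'v \<Rightarrow>\<^sub>L real" where g: "\<And>c. c \<in> C - {b} \<Longrightarrow> g c = 0" "g b \<noteq> 0"
      by blast
    then show ?thesis
      by (intro exI[of _ "inverse (g b) *\<^sub>R g"]) (auto simp: blinfun.scaleR_left)
  qed
  then obtain f :: "'v \<Rightarrow> 'v \<Rightarrow>\<^sub>L real" where f: "\<And>b. b \<in> C \<Longrightarrow> blinfun_apply (f b) b = 1"
      "\<And>b c. b \<in> C \<Longrightarrow> c \<in> C - {b} \<Longrightarrow> blinfun_apply (f b) c = 0" by metis
  have "v = (\<Sum>b\<in>C. f b v *\<^sub>R b)" if "v \<in> span C" for v
    using that
  proof (induction rule: span_induct_alt)
    case (step a x y)
    have "(\<Sum>b\<in>C. f b x *\<^sub>R b) = (\<Sum>b\<in>C. if b = x then x else 0)"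
      by (rule sum.cong) (use f step(1) in force)+
    also have "\<dots> = x" using fin step(1) by simp
    finally have x: "x = (\<Sum>b\<in>C. f b x *\<^sub>R b)" by simp
    have "(\<Sum>b\<in>C. f b (a *\<^sub>R x + y) *\<^sub>R b) = a *\<^sub>R (\<Sum>b\<in>C. f b x *\<^sub>R b) + (\<Sum>b\<in>C. f b y *\<^sub>R b)"
      by (simp add: blinfun.bilinear_simps scaleR_add_left sum.distrib scaleR_sum_right)
    then show ?case unfolding x[symmetric] step.IH[symmetric] by (rule sym)
  qed simp
  moreover have "span B \<subseteq> span C" using C(3) by (simp add: span_minimal)
  ultimately show thesis using that[OF fin] by blast
qed

section \<open>Elementary tensors and functionals given by bilinear forms\<close>

definition ptens :: "'a::real_normed_vector \<Rightarrow> 'b::real_normed_vector \<Rightarrow> ('a, 'b) proj_tensor"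
  where "ptens x y = of_tensor (tens x y)"

lemma norm_ptens_le: "norm (ptens x y) \<le> norm x * norm y"
  using proj_norm_le[of "tens x y" "[(x, y)]"] by (simp add: ptens_def norm_of_tensor)

lemma norm_ptens_le_1: "norm x \<le> 1 \<Longrightarrow> norm y \<le> 1 \<Longrightarrow> norm (ptens x y) \<le> 1"
  using norm_ptens_le[of x y] by (meson mult_le_one norm_ge_zero order_trans)

interpretation ptens: bounded_bilinear ptens
proof
  show "\<exists>K. \<forall>a b. norm (ptens a b) \<le> norm a * norm b * K"
    by (intro exI[of _ 1] allI) (simp add: norm_ptens_le)
qed (simp_all add: ptens_def bilinear_ladd[OF bilinear_tens] bilinear_radd[OF bilinear_tens]
    bilinear_lmul[OF bilinear_tens] bilinear_rmul[OF bilinear_tens]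
    linear_add[OF linear_of_tensor] linear_scale[OF linear_of_tensor])

lemma closure_span_ptens:
  "closure (span {ptens (x :: 'a::real_normed_vector) (y :: 'b::real_normed_vector) | x y. True}) = UNIV"
proof -
  have "of_tensor z \<in> span {ptens x y | x y. True}" for z :: "('a, 'b) tensor"
  proof -
    obtain u where "z = (\<Sum>(x, y)\<leftarrow>u. tens x y)" using tensor_eq_sum by blast
    moreover have "of_tensor (\<Sum>(x, y)\<leftarrow>u. tens x y) \<in> span {ptens x y | x y. True}"
    proof (induction u)
      case Nil
      then show ?case by (simp add: linear_0[OF linear_of_tensor] span_zero)
    next
      case (Cons p u)
      have "of_tensor (tens (fst p) (snd p)) \<in> span {ptens x y | x y. True}"
        by (rule span_base) (auto simp: ptens_def)
      with Cons show ?case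
        by (simp add: case_prod_unfold linear_add[OF linear_of_tensor] span_add)
    qed
    ultimately show ?thesis by simp
  qed
  then have "range (of_tensor :: ('a, 'b) tensor \<Rightarrow> _) \<subseteq> span {ptens x y | x y. True}" by auto
  from closure_mono[OF this] show ?thesis unfolding of_tensor_dense by auto
qed

lemma functional_eqI:
  fixes \<phi> \<psi> :: "('a::real_normed_vector, 'b::real_normed_vector) proj_tensor \<Rightarrow>\<^sub>L real"
  assumes "\<And>x y. \<phi> (ptens x y) = \<psi> (ptens x y)"
  shows "\<phi> = \<psi>"
proof -
  have "closed {z. \<phi> z = \<psi> z}" by (intro closed_Collect_eq continuous_intros)
  moreover have "span {ptens x y | x y. True} \<subseteq> {z. \<phi> z = \<psi> z}"
    by (rule span_minimal) (use assms in \<open>auto intro!: subspaceI simp: blinfun.bilinear_simps\<close>)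
  ultimately have "closure (span {ptens x y | x y. True}) \<subseteq> {z. \<phi> z = \<psi> z}"
    by (rule closure_minimal[rotated])
  then show ?thesis unfolding closure_span_ptens by (intro blinfun_eqI) auto
qed

text \<open>A bilinear form has a well-defined value on each algebraic tensor because tensors are
  identified by exactly these values. Near-optimal representations bound it by \<open>c\<close>
  times the projective norm, and Hahn-Banach along \<open>of_tensor\<close> extends it to the
  completion.\<close>

lemma functional_of_form:
  fixes B :: "'a::real_normed_vector \<Rightarrow> 'b::real_normed_vector \<Rightarrow> real"
  assumes B: "bilinear B" and c: "c \<ge> 0" and le: "\<And>x y. B x y \<le> c * (norm x * norm y)"
  obtains \<phi> :: "('a, 'b) proj_tensor \<Rightarrow>\<^sub>L real"
  where "\<And>x y. \<phi> (ptens x y) = B x y" "norm \<phi> \<le> c"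
proof -
  define g where "g z = eval_sum B (rep_tensor z)" for z :: "('a, 'b) tensor"
  have g_abs: "g (abs_tensor u) = eval_sum B u" for u
    using Quotient_rep_abs[OF Quotient_tensor, of u] B by (simp add: g_def)
  have surj: "\<exists>u. z = abs_tensor u" for z :: "('a, 'b) tensor"
    using Quotient_abs_rep[OF Quotient_tensor] by metis
  have g_lin: "linear g"
  proof (rule linearI)
    show "g (z + w) = g z + g w" for z w
      using surj[of z] surj[of w] by (auto simp: plus_tensor.abs_eq g_abs)
    show "g (a *\<^sub>R z) = a *\<^sub>R g z" for a z
      using surj[of z] by (auto simp: scaleR_tensor.abs_eq g_abs eval_sum_scale[OF B])
  qed
  have g_le: "g z \<le> c * norm (of_tensor z)" for z
  proof -
    have "g z \<le> c * (proj_norm z + e)" if e: "e > 0" for e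
    proof -
      obtain u where u: "z = (\<Sum>(x, y)\<leftarrow>u. tens x y)" "(\<Sum>(x, y)\<leftarrow>u. norm x * norm y) < proj_norm z + e"
        using proj_norm_approx[OF e] .
      have "eval_sum B u \<le> c * (\<Sum>(x, y)\<leftarrow>u. norm x * norm y)"
        by (induction u) (auto simp: distrib_left intro!: add_mono le)
      also have "\<dots> \<le> c * (proj_norm z + e)" using u(2) c by (intro mult_left_mono) auto
      finally show ?thesis by (simp add: u(1) sum_tens_eq_abs g_abs)
    qed
    then have "\<forall>\<^sub>F e in at_right 0. g z \<le> c * (proj_norm z + e)"
      by (rule eventually_mono[OF eventually_at_right_less])
    moreover have "((\<lambda>e. c * (proj_norm z + e)) \<longlongrightarrow> c * (proj_norm z + 0)) (at_right 0)"
      by (intro tendsto_intros)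
    ultimately have "g z \<le> c * (proj_norm z + 0)"
      by (intro tendsto_lowerbound[OF _ _ trivial_limit_at_right_real])
    then show ?thesis by (simp add: norm_of_tensor)
  qed
  obtain \<phi> :: "('a, 'b) proj_tensor \<Rightarrow>\<^sub>L real"
    where \<phi>: "\<And>z. z \<in> UNIV \<Longrightarrow> \<phi> (of_tensor z) = g z" "norm \<phi> \<le> c"
    using hahn_banach_norm[OF c linear_of_tensor g_lin subspace_UNIV] g_le by metis
  have "\<phi> (ptens x y) = B x y" for x y
    by (simp add: ptens_def \<phi>(1) tens.abs_eq g_abs)
  with \<phi>(2) show thesis by (rule that[rotated])
qed

text \<open>The values on elementary tensors determine \<open>\<phi>\<close>, so
  \<open>\<phi>\<close> coincides with the functional of norm at most \<open>c\<close> built from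
  its own bilinear form.\<close>

lemma norm_functional_le:
  fixes \<phi> :: "('a::real_normed_vector, 'b::real_normed_vector) proj_tensor \<Rightarrow>\<^sub>L real"
  assumes "c \<ge> 0" "\<And>x y. \<phi> (ptens x y) \<le> c * (norm x * norm y)"
  shows "norm \<phi> \<le> c"
proof -
  have "bilinear (\<lambda>x y. \<phi> (ptens x y))"
    by (auto simp: bilinear_def intro!: linearI simp: ptens.add_left ptens.add_right
        ptens.scaleR_left ptens.scaleR_right blinfun.bilinear_simps)
  then obtain \<psi> :: "('a, 'b) proj_tensor \<Rightarrow>\<^sub>L real"
    where "\<And>x y. \<psi> (ptens x y) = \<phi> (ptens x y)" "norm \<psi> \<le> c"
    using functional_of_form[OF _ assms] by blast
  then show ?thesis using functional_eqI by metis
qed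

section \<open>Rank-one functionals and the metric approximation property\<close>

text \<open>These are the elementary tensors of the two duals, seen in the dual of the completion;
  their span corresponds to the bounded bilinear forms of finite rank.\<close>

definition rank_one_functionals :: "(('a::real_normed_vector, 'b::real_normed_vector) proj_tensor \<Rightarrow>\<^sub>L real) set"
  where "rank_one_functionals =
    {\<phi>. \<exists>(f :: 'a \<Rightarrow>\<^sub>L real) (g :: 'b \<Rightarrow>\<^sub>L real). \<forall>x y. blinfun_apply \<phi> (ptens x y) = f x * g y}"

lemma rank_one_sum:
  fixes \<phi> :: "('a::real_normed_vector, 'b::real_normed_vector) proj_tensor \<Rightarrow>\<^sub>L real"
    and f :: "'i \<Rightarrow> 'a \<Rightarrow>\<^sub>L real" and g :: "'i \<Rightarrow> 'b \<Rightarrow>\<^sub>L real"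
  assumes "\<And>x y. \<phi> (ptens x y) = (\<Sum>i\<in>I. f i x * g i y)"
  shows "\<phi> \<in> span rank_one_functionals"
proof -
  have "\<exists>\<rho> :: ('a, 'b) proj_tensor \<Rightarrow>\<^sub>L real. \<forall>x y. blinfun_apply \<rho> (ptens x y) = f i x * g i y" for i
  proof -
    have bil: "bilinear (\<lambda>x y. f i x * g i y)"
      by (auto simp: bilinear_def intro!: linearI simp: blinfun.bilinear_simps algebra_simps)
    have "f i x * g i y \<le> norm (f i) * norm (g i) * (norm x * norm y)" for x y
    proof -
      have "f i x * g i y \<le> norm (f i x) * norm (g i y)"
        using abs_ge_self[of "f i x * g i y"] by (simp add: abs_mult)
      also have "\<dots> \<le> (norm (f i) * norm x) * (norm (g i) * norm y)"
        by (intro mult_mono norm_blinfun) auto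
      finally show ?thesis by (simp add: mult_ac)
    qed
    from functional_of_form[OF bil _ this] show ?thesis by (metis mult_nonneg_nonneg norm_ge_zero)
  qed
  then obtain \<rho> where \<rho>: "\<And>i x y. blinfun_apply (\<rho> i) (ptens x y) = f i x * g i y" by metis
  have "\<phi> = (\<Sum>i\<in>I. \<rho> i)"
    by (rule functional_eqI) (simp add: assms \<rho> blinfun.sum_left)
  moreover have "\<rho> i \<in> rank_one_functionals" for i unfolding rank_one_functionals_def using \<rho> by blast
  ultimately show ?thesis by (simp add: span_sum span_base)
qed

lemma finite_rank_expansion:
  assumes "finite_rank S"
  obtains C and f :: "'b \<Rightarrow> 'b::real_normed_vector \<Rightarrow>\<^sub>L real"
  where "finite C" "\<And>x. blinfun_apply S x = (\<Sum>b\<in>C. f b (S x) *\<^sub>R b)"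
proof -
  obtain B where B: "finite B" "range (blinfun_apply S) \<subseteq> span B"
    using assms unfolding finite_rank_def by blast
  obtain C and f :: "'b \<Rightarrow> 'b \<Rightarrow>\<^sub>L real"
    where "finite C" "\<And>v. v \<in> span B \<Longrightarrow> v = (\<Sum>b\<in>C. f b v *\<^sub>R b)"
    by (rule finite_span_coordinates[OF B(1)]) (rule that)
  with B(2) that show thesis by blast
qed

text \<open>The functional is \<open>\<phi>\<close> composed with \<open>S \<otimes> R\<close>,
  obtained from its bilinear form so that the operator \<open>S \<otimes> R\<close> need not be
  built on the completion.\<close>

lemma compose_functional:
  fixes \<phi> :: "('a::real_normed_vector, 'b::real_normed_vector) proj_tensor \<Rightarrow>\<^sub>L real"
    and S :: "'a \<Rightarrow>\<^sub>L 'a" and R :: "'b \<Rightarrow>\<^sub>L 'b"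
  obtains \<psi> :: "('a, 'b) proj_tensor \<Rightarrow>\<^sub>L real"
  where "\<And>x y. \<psi> (ptens x y) = \<phi> (ptens (S x) (R y))" "norm \<psi> \<le> norm \<phi> * (norm S * norm R)"
proof (rule functional_of_form)
  show "bilinear (\<lambda>x y. \<phi> (ptens (S x) (R y)))"
    by (auto simp: bilinear_def intro!: linearI simp: ptens.add_left ptens.add_right
        ptens.scaleR_left ptens.scaleR_right blinfun.bilinear_simps)
  fix x y
  have "\<phi> (ptens (S x) (R y)) \<le> norm \<phi> * norm (ptens (S x) (R y))"
    using norm_blinfun[of \<phi> "ptens (S x) (R y)"] by simp
  also have "\<dots> \<le> norm \<phi> * ((norm S * norm x) * (norm R * norm y))"
    by (intro mult_left_mono order_trans[OF norm_ptens_le] mult_mono norm_blinfun) auto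
  finally show "\<phi> (ptens (S x) (R y)) \<le> norm \<phi> * (norm S * norm R) * (norm x * norm y)"
    by (simp add: mult_ac)
qed auto

text \<open>Composing a functional norming \<open>z\<close> with \<open>S s \<otimes> R s\<close>
  gives functionals in the unit ball that converge at \<open>z\<close>, and each is a finite sum
  since one factor has finite rank. Allowing both operators to vary treats approximation in either
  space at once, with the identity on the other side.\<close>

lemma rank_one_norming_of_net:
  fixes S :: "'s \<Rightarrow> 'a::real_normed_vector \<Rightarrow>\<^sub>L 'a" and R :: "'s \<Rightarrow> 'b::real_normed_vector \<Rightarrow>\<^sub>L 'b"
    and z :: "('a, 'b) proj_tensor"
  assumes F: "F \<noteq> bot"
    and ev: "\<forall>\<^sub>F s in F. norm (S s) \<le> 1 \<and> norm (R s) \<le> 1 \<and> (finite_rank (S s) \<or> finite_rank (R s))"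
    and lim: "\<And>x. ((\<lambda>s. S s x) \<longlongrightarrow> x) F" "\<And>y. ((\<lambda>s. R s y) \<longlongrightarrow> y) F" and e: "e > 0"
  shows "\<exists>\<psi>\<in>span rank_one_functionals. norm \<psi> \<le> 1 \<and> norm z - e \<le> blinfun_apply \<psi> z"
proof -
  obtain \<phi> :: "('a, 'b) proj_tensor \<Rightarrow>\<^sub>L real" where \<phi>: "\<phi> z = norm z" "norm \<phi> \<le> 1"
    by (rule norming_functional)
  have "\<exists>\<psi>. (\<forall>x y. blinfun_apply \<psi> (ptens x y) = \<phi> (ptens (S s x) (R s y))) \<and>
      norm \<psi> \<le> norm \<phi> * (norm (S s) * norm (R s))" for s
    by (rule compose_functional[of \<phi> "S s" "R s"]) blast
  then obtain \<psi> where \<psi>: "\<And>s x y. blinfun_apply (\<psi> s) (ptens x y) = \<phi> (ptens (S s x) (R s y))"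
      "\<And>s. norm (\<psi> s) \<le> norm \<phi> * (norm (S s) * norm (R s))" by metis
  have "\<forall>\<^sub>F s in F. norm (\<psi> s) \<le> 1 \<and> \<psi> s \<in> span rank_one_functionals"
    using ev
  proof eventually_elim
    case (elim s)
    have "norm \<phi> * (norm (S s) * norm (R s)) \<le> 1"
      using elim \<phi>(2) by (intro mult_le_one mult_nonneg_nonneg) auto
    then have "norm (\<psi> s) \<le> 1" using \<psi>(2) order_trans by blast
    moreover have "\<psi> s \<in> span rank_one_functionals"
      using elim
    proof (elim conjE disjE)
      assume "finite_rank (S s)"
      then obtain C and f :: "'a \<Rightarrow> 'a \<Rightarrow>\<^sub>L real"
        where C: "finite C" "\<And>x. S s x = (\<Sum>b\<in>C. f b (S s x) *\<^sub>R b)"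
        using finite_rank_expansion by blast
      show ?thesis
      proof (rule rank_one_sum)
        fix x y
        have "\<psi> s (ptens x y) = \<phi> (ptens (\<Sum>b\<in>C. f b (S s x) *\<^sub>R b) (R s y))"
          using \<psi>(1) C(2) by metis
        then show "\<psi> s (ptens x y) =
            (\<Sum>b\<in>C. (f b o\<^sub>L S s) x * (\<phi> o\<^sub>L Blinfun (ptens b) o\<^sub>L R s) y)"
          by (simp add: ptens.sum_left ptens.scaleR_left blinfun.bilinear_simps blinfun.sum_right
              bounded_linear_Blinfun_apply[OF ptens.bounded_linear_right])
      qed
    next
      assume "finite_rank (R s)"
      then obtain C and f :: "'b \<Rightarrow> 'b \<Rightarrow>\<^sub>L real"
        where C: "finite C" "\<And>x. R s x = (\<Sum>b\<in>C. f b (R s x) *\<^sub>R b)"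
        using finite_rank_expansion by blast
      show ?thesis
      proof (rule rank_one_sum)
        fix x y
        have "\<psi> s (ptens x y) = \<phi> (ptens (S s x) (\<Sum>b\<in>C. f b (R s y) *\<^sub>R b))"
          using \<psi>(1) C(2) by metis
        then show "\<psi> s (ptens x y) =
            (\<Sum>b\<in>C. (\<phi> o\<^sub>L Blinfun (\<lambda>x. ptens x b) o\<^sub>L S s) x * (f b o\<^sub>L R s) y)"
          by (simp add: ptens.sum_right ptens.scaleR_right blinfun.bilinear_simps blinfun.sum_right
              bounded_linear_Blinfun_apply[OF ptens.bounded_linear_left] mult.commute)
      qed
    qed
    ultimately show ?case ..
  qed
  moreover have "((\<lambda>s. \<psi> s z) \<longlongrightarrow> \<phi> z) F"
  proof (rule tendsto_closure_span)
    show "((\<lambda>s. \<psi> s v) \<longlongrightarrow> \<phi> v) F" if v: "v \<in> {ptens x y | x y. True}" for v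
    proof -
      obtain x y where "v = ptens x y" using v by blast
      moreover have "((\<lambda>s. \<phi> (ptens (S s x) (R s y))) \<longlongrightarrow> \<phi> (ptens x y)) F"
        by (intro blinfun.tendsto tendsto_const ptens.tendsto lim)
      ultimately show ?thesis by (simp add: \<psi>(1))
    qed
    show "\<forall>\<^sub>F s in F. norm (\<psi> s) \<le> 1" using calculation by eventually_elim simp
  qed (use \<phi>(2) closure_span_ptens in auto)
  then have "\<forall>\<^sub>F s in F. norm z - e < \<psi> s z" using e \<phi>(1) by (intro order_tendstoD(1)) auto
  ultimately have "\<forall>\<^sub>F s in F. norm (\<psi> s) \<le> 1 \<and> \<psi> s \<in> span rank_one_functionals \<and> norm z - e < \<psi> s z"
    by eventually_elim simp
  then obtain s where "norm (\<psi> s) \<le> 1 \<and> \<psi> s \<in> span rank_one_functionals \<and> norm z - e < \<psi> s z"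
    using eventually_happens'[OF F] by blast
  then show ?thesis by (intro bexI[of _ "\<psi> s"]) auto
qed

lemma rank_one_norming:
  fixes z :: "('a::real_normed_vector, 'b::real_normed_vector) proj_tensor"
  assumes map: "metric_approximation_property TYPE('a) \<or> metric_approximation_property TYPE('b)"
    and e: "e > 0"
  shows "\<exists>\<psi>\<in>span rank_one_functionals. norm \<psi> \<le> 1 \<and> norm z - e \<le> blinfun_apply \<psi> z"
  using map
proof
  assume "metric_approximation_property TYPE('a)"
  then obtain F :: "('a \<Rightarrow>\<^sub>L 'a) filter" where F: "F \<noteq> bot"
      "\<forall>\<^sub>F S in F. finite_rank S \<and> norm S \<le> 1" "\<And>x. ((\<lambda>S. blinfun_apply S x) \<longlongrightarrow> x) F"
    unfolding metric_approximation_property_def by blast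
  show ?thesis
    by (rule rank_one_norming_of_net[OF F(1), where S="\<lambda>S. S" and R="\<lambda>_. id_blinfun"])
       (use F e in \<open>auto elim!: eventually_mono simp: norm_blinfun_id_le\<close>)
next
  assume "metric_approximation_property TYPE('b)"
  then obtain F :: "('b \<Rightarrow>\<^sub>L 'b) filter" where F: "F \<noteq> bot"
      "\<forall>\<^sub>F S in F. finite_rank S \<and> norm S \<le> 1" "\<And>x. ((\<lambda>S. blinfun_apply S x) \<longlongrightarrow> x) F"
    unfolding metric_approximation_property_def by blast
  show ?thesis
    by (rule rank_one_norming_of_net[OF F(1), where R="\<lambda>S. S" and S="\<lambda>_. id_blinfun"])
       (use F e in \<open>auto elim!: eventually_mono simp: norm_blinfun_id_le\<close>)
qed

section \<open>Compactness and reflexivity\<close>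

text \<open>Induction over the span: adding \<open>c\<close> times a rank-one functional
  \<open>f \<otimes> g\<close> enlarges \<open>K\<close> by a compact segment of multiples of
  \<open>g\<close>, because \<open>f\<close> is bounded on the unit ball.\<close>

lemma compact_form_image:
  fixes \<phi> :: "('a::real_normed_vector, 'b::real_normed_vector) proj_tensor \<Rightarrow>\<^sub>L real"
  assumes "\<phi> \<in> span rank_one_functionals"
  shows "\<exists>K :: ('b \<Rightarrow>\<^sub>L real) set. compact K \<and>
    (\<forall>x. norm x \<le> 1 \<longrightarrow> (\<exists>k\<in>K. \<forall>y. blinfun_apply k y = \<phi> (ptens x y)))"
  using assms
proof (induction rule: span_induct_alt)
  case base
  show ?case by (rule exI[of _ "{0}"]) simp
next
  case (step c \<rho> \<phi>)
  from step(1) obtain f :: "'a \<Rightarrow>\<^sub>L real" and g :: "'b \<Rightarrow>\<^sub>L real"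
    where fg: "\<And>x y. \<rho> (ptens x y) = f x * g y" unfolding rank_one_functionals_def by blast
  from step(2) obtain K where K: "compact K"
    "\<And>x. norm x \<le> 1 \<Longrightarrow> \<exists>k\<in>K. \<forall>y. blinfun_apply k y = \<phi> (ptens x y)" by blast
  let ?L = "(\<lambda>t. t *\<^sub>R g) ` cball 0 (\<bar>c\<bar> * norm f)"
  show ?case
  proof (intro exI[of _ "{l + k | l k. l \<in> ?L \<and> k \<in> K}"] conjI allI impI)
    show "compact {l + k | l k. l \<in> ?L \<and> k \<in> K}"
      by (intro compact_sums compact_continuous_image continuous_intros K(1)) simp
    fix x :: 'a assume x: "norm x \<le> 1"
    obtain k where k: "k \<in> K" "\<forall>y. blinfun_apply k y = \<phi> (ptens x y)" using K(2)[OF x] by blast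
    have "\<bar>f x\<bar> \<le> norm f * 1"
      using norm_blinfun[of f x] mult_left_mono[OF x, of "norm f"] by simp
    then have "\<bar>c * f x\<bar> \<le> \<bar>c\<bar> * norm f" by (simp add: abs_mult mult_left_mono)
    then have "(c * f x) *\<^sub>R g \<in> ?L" by (intro imageI) (simp add: dist_norm)
    with k show "\<exists>k\<in>{l + k | l k. l \<in> ?L \<and> k \<in> K}. \<forall>y. blinfun_apply k y = (c *\<^sub>R \<rho> + \<phi>) (ptens x y)"
      by (intro bexI[of _ "(c * f x) *\<^sub>R g + k"]) (auto simp: blinfun.bilinear_simps fg)
  qed
qed

text \<open>Viewed as a functional on the tensor product, \<open>T\<close> is a norm limit of finite
  sums, and closeness there bounds the distance between \<open>T x\<close> and the approximating
  functional uniformly for \<open>x\<close> in the unit ball.\<close>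

lemma compact_operator_if_dense:
  fixes T :: "'a::real_normed_vector \<Rightarrow>\<^sub>L ('b::real_normed_vector \<Rightarrow>\<^sub>L real)"
  assumes dense: "\<And>\<phi> :: ('a, 'b) proj_tensor \<Rightarrow>\<^sub>L real. \<phi> \<in> closure (span rank_one_functionals)"
  shows "compact_operator T"
  unfolding compact_operator_def compact_eq_totally_bounded
proof (intro conjI allI impI)
  show "complete (closure (T ` cball 0 1))" by (simp add: complete_eq_closed)
  fix e :: real assume e: "e > 0"
  have bil: "bilinear (\<lambda>x y. T x y)"
    by (auto simp: bilinear_def intro!: linearI simp: blinfun.bilinear_simps)
  have "T x y \<le> norm T * (norm x * norm y)" for x y
  proof -
    have "T x y \<le> norm (T x) * norm y" using norm_blinfun[of "T x" y] by simp
    also have "\<dots> \<le> (norm T * norm x) * norm y" by (intro mult_right_mono norm_blinfun) simp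
    finally show ?thesis by (simp add: mult_ac)
  qed
  from functional_of_form[OF bil norm_ge_zero this]
  obtain \<phi> :: "('a, 'b) proj_tensor \<Rightarrow>\<^sub>L real" where \<phi>: "\<And>x y. \<phi> (ptens x y) = T x y" by metis
  obtain \<psi> where \<psi>: "\<psi> \<in> span rank_one_functionals" "dist \<psi> \<phi> < e / 4"
    using dense[of \<phi>] e unfolding closure_approachable by (metis zero_less_divide_iff zero_less_numeral)
  obtain K :: "('b \<Rightarrow>\<^sub>L real) set" where K: "compact K"
    "\<And>x. norm x \<le> 1 \<Longrightarrow> \<exists>k\<in>K. \<forall>y. blinfun_apply k y = \<psi> (ptens x y)"
    using compact_form_image[OF \<psi>(1)] by blast
  have "e / 4 > 0" using e by simp
  then obtain N where N: "finite N" "K \<subseteq> (\<Union>n\<in>N. ball n (e / 4))"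
    using K(1) unfolding compact_eq_totally_bounded by blast
  \<comment> \<open>Closed balls of half the radius are used so that the covering passes to the
    closure.\<close>
  have "T ` cball 0 1 \<subseteq> (\<Union>n\<in>N. cball n (e / 2))"
  proof
    fix h assume "h \<in> T ` cball 0 1"
    then obtain x where x: "norm x \<le> 1" "h = T x" by auto
    obtain k where k: "k \<in> K" "\<And>y. blinfun_apply k y = \<psi> (ptens x y)" using K(2)[OF x(1)] by blast
    have "norm (k - h) \<le> e / 4"
    proof (rule norm_blinfun_bound)
      fix y
      have "norm ((k - h) y) = norm ((\<psi> - \<phi>) (ptens x y))"
        by (simp add: x(2) k(2) \<phi> blinfun.diff_left)
      also have "\<dots> \<le> norm (\<psi> - \<phi>) * (norm x * norm y)"
        by (rule order_trans[OF norm_blinfun]) (intro mult_left_mono norm_ptens_le norm_ge_zero)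
      also have "\<dots> \<le> (e / 4) * (1 * norm y)"
        using \<psi>(2) x(1) e by (intro mult_mono) (auto simp: dist_norm)
      finally show "norm ((k - h) y) \<le> e / 4 * norm y" by simp
    qed (use e in simp)
    moreover obtain n where "n \<in> N" "dist n k < e / 4" using N(2) k(1) by auto
    moreover have "dist n h \<le> dist n k + dist k h" by (rule dist_triangle)
    ultimately show "h \<in> (\<Union>n\<in>N. cball n (e / 2))" by (force simp: dist_norm)
  qed
  then have "closure (T ` cball 0 1) \<subseteq> (\<Union>n\<in>N. cball n (e / 2))"
    using N(1) by (intro closure_minimal closed_UN) auto
  also have "\<dots> \<subseteq> (\<Union>n\<in>N. ball n e)" using e by force
  finally show "\<exists>k. finite k \<and> closure (T ` cball 0 1) \<subseteq> (\<Union>x\<in>k. ball x e)" using N(1) by blast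
qed

section \<open>Weak cluster points and reflexivity\<close>

text \<open>Tychonoff's theorem for a product of intervals; a finer proper filter
  \<open>G \<le> F\<close> plays the part of a subnet.\<close>

lemma bounded_net_pointwise_cluster:
  fixes p :: "'i \<Rightarrow> 'j \<Rightarrow> real"
  assumes F: "F \<noteq> bot" and bd: "\<And>i j. \<bar>p i j\<bar> \<le> M j"
  obtains G l where "G \<noteq> bot" "G \<le> F" "\<And>j. ((\<lambda>i. p i j) \<longlongrightarrow> l j) G" "\<And>j. \<bar>l j\<bar> \<le> M j"
proof -
  let ?K = "PiE UNIV (\<lambda>j. cball 0 (M j)) :: ('j \<Rightarrow> real) set"
  have "compactin (product_topology (\<lambda>_. euclidean) UNIV) ?K" by (simp add: compactin_PiE)
  then have "compact ?K" by (simp add: euclidean_product_topology)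
  moreover have "filtermap p F \<noteq> bot" using F by (simp add: filtermap_bot_iff)
  moreover have "\<forall>\<^sub>F x in filtermap p F. x \<in> ?K" using bd by (simp add: eventually_filtermap PiE_iff)
  ultimately obtain l where l: "l \<in> ?K" "inf (nhds l) (filtermap p F) \<noteq> bot"
    unfolding compact_filter by blast
  \<comment> \<open>Adding the preimages of the neighbourhoods of \<open>l\<close> to
    \<open>F\<close> forces convergence; the result is proper because \<open>l\<close> is a cluster
    point.\<close>
  define G where "G = inf F (filtercomap p (nhds l))"
  have "G \<noteq> bot"
  proof
    assume "G = bot"
    then have "eventually (\<lambda>_. False) G" by simp
    then obtain Q P where QP: "eventually Q F" "eventually P (nhds l)" "\<And>i. Q i \<Longrightarrow> \<not> P (p i)"
      unfolding G_def eventually_inf eventually_filtercomap by blast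
    have "\<forall>\<^sub>F x in filtermap p F. \<not> P x"
      unfolding eventually_filtermap using QP(1,3) by (rule eventually_mono)
    with QP(2) have "eventually (\<lambda>_. False) (inf (nhds l) (filtermap p F))"
      unfolding eventually_inf by blast
    with l(2) show False by (simp add: eventually_False)
  qed
  moreover have "G \<le> F" by (simp add: G_def)
  moreover have "((\<lambda>i. p i j) \<longlongrightarrow> l j) G" for j
  proof -
    have "filterlim p (nhds l) G" unfolding G_def
      by (rule filterlim_mono[OF filterlim_filtercomap order_refl]) simp
    then show ?thesis
      by (rule continuous_on_tendsto_compose[OF continuous_on_product_coordinates]) auto
  qed
  moreover have "\<bar>l j\<bar> \<le> M j" for j using l(1) by (auto simp: PiE_iff)
  ultimately show thesis by (rule that)
qed

text \<open>A pointwise limit on the dual is linear and bounded by the norm, so it lies in the unit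
  ball of the bidual, and reflexivity represents it by a vector.\<close>

lemma reflexive_weak_cluster:
  fixes xs :: "'i \<Rightarrow> 'a::real_normed_vector"
  assumes refl: "reflexive_space TYPE('a)" and F: "F \<noteq> bot" and xs: "\<And>i. norm (xs i) \<le> 1"
  obtains G x where "G \<noteq> bot" "G \<le> F" "norm x \<le> 1"
    "\<And>f :: 'a \<Rightarrow>\<^sub>L real. ((\<lambda>i. f (xs i)) \<longlongrightarrow> f x) G"
proof -
  have "\<bar>f (xs i)\<bar> \<le> norm f" for f :: "'a \<Rightarrow>\<^sub>L real" and i
    using norm_blinfun[of f "xs i"] mult_left_mono[OF xs[of i], of "norm f"] by simp
  then obtain G and l :: "('a \<Rightarrow>\<^sub>L real) \<Rightarrow> real" where G: "G \<noteq> bot" "G \<le> F"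
      and lim: "\<And>f. ((\<lambda>i. blinfun_apply f (xs i)) \<longlongrightarrow> l f) G" and le: "\<And>f. \<bar>l f\<bar> \<le> norm f"
    using bounded_net_pointwise_cluster[OF F, of "\<lambda>i f. blinfun_apply f (xs i)" norm] by blast
  have "linear l"
  proof (rule linearI)
    show "l (f + g) = l f + l g" for f g
      by (rule tendsto_unique[OF G(1) lim]) (simp add: blinfun.add_left tendsto_add lim)
    show "l (c *\<^sub>R f) = c *\<^sub>R l f" for c f
      by (rule tendsto_unique[OF G(1) lim]) (simp add: blinfun.scaleR_left tendsto_mult_left lim)
  qed
  moreover have "l f \<le> 1 * norm f" for f using le[of f] by simp
  ultimately obtain \<Phi> :: "('a \<Rightarrow>\<^sub>L real) \<Rightarrow>\<^sub>L real" where \<Phi>: "blinfun_apply \<Phi> = l" "norm \<Phi> \<le> 1"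
    by (rule linear_bounded_blinfun) auto
  obtain x where x: "\<Phi> = bidual_embedding x" using refl unfolding reflexive_space_def by blast
  have "norm x \<le> 1" using \<Phi>(2) by (simp add: x norm_bidual_embedding)
  moreover have "((\<lambda>i. f (xs i)) \<longlongrightarrow> f x) G" for f :: "'a \<Rightarrow>\<^sub>L real"
    using lim[of f] by (simp add: x bidual_embedding.rep_eq flip: \<Phi>(1))
  ultimately show thesis using that G by blast
qed

text \<open>After refining the filter once for each factor, a rank-one functional converges as a
  product of two scalar limits; density of their span and boundedness extend this to every
  \<open>\<phi>\<close>.\<close>

lemma ptens_weak_cluster:
  fixes xs :: "'i \<Rightarrow> 'a::real_normed_vector" and ys :: "'i \<Rightarrow> 'b::real_normed_vector"
  assumes refl: "reflexive_space TYPE('a)" "reflexive_space TYPE('b)"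
    and dense: "\<And>\<phi> :: ('a, 'b) proj_tensor \<Rightarrow>\<^sub>L real. \<phi> \<in> closure (span rank_one_functionals)"
    and F: "F \<noteq> bot" and xs: "\<And>i. norm (xs i) \<le> 1" and ys: "\<And>i. norm (ys i) \<le> 1"
  obtains G x y where "G \<noteq> bot" "G \<le> F" "norm x \<le> 1" "norm y \<le> 1"
    "\<And>\<phi> :: ('a, 'b) proj_tensor \<Rightarrow>\<^sub>L real. ((\<lambda>i. \<phi> (ptens (xs i) (ys i))) \<longlongrightarrow> \<phi> (ptens x y)) G"
proof -
  obtain H x where H: "H \<noteq> bot" "H \<le> F" "norm x \<le> 1"
    "\<And>f :: 'a \<Rightarrow>\<^sub>L real. ((\<lambda>i. f (xs i)) \<longlongrightarrow> f x) H"
    using reflexive_weak_cluster[where xs=xs, OF refl(1) F xs] by blast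
  obtain G y where G: "G \<noteq> bot" "G \<le> H" "norm y \<le> 1"
    "\<And>g :: 'b \<Rightarrow>\<^sub>L real. ((\<lambda>i. g (ys i)) \<longlongrightarrow> g y) G"
    using reflexive_weak_cluster[where xs=ys, OF refl(2) H(1) ys] by blast
  have "((\<lambda>i. \<phi> (ptens (xs i) (ys i))) \<longlongrightarrow> \<phi> (ptens x y)) G"
    for \<phi> :: "('a, 'b) proj_tensor \<Rightarrow>\<^sub>L real"
  proof -
    have "((\<lambda>i. bidual_embedding (ptens (xs i) (ys i)) \<phi>) \<longlongrightarrow> bidual_embedding (ptens x y) \<phi>) G"
    proof (rule tendsto_closure_span[OF _ _ _ dense])
      fix \<rho> :: "('a, 'b) proj_tensor \<Rightarrow>\<^sub>L real" assume "\<rho> \<in> rank_one_functionals"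
      then obtain f :: "'a \<Rightarrow>\<^sub>L real" and g :: "'b \<Rightarrow>\<^sub>L real"
        where "\<And>x y. \<rho> (ptens x y) = f x * g y" unfolding rank_one_functionals_def by blast
      then show "((\<lambda>i. bidual_embedding (ptens (xs i) (ys i)) \<rho>) \<longlongrightarrow> bidual_embedding (ptens x y) \<rho>) G"
        using tendsto_mult[OF tendsto_mono[OF G(2) H(4)] G(4)] by (simp add: bidual_embedding.rep_eq)
    qed (use xs ys H(3) G(3) in \<open>simp_all add: norm_bidual_embedding norm_ptens_le_1\<close>)
    then show ?thesis by (simp add: bidual_embedding.rep_eq)
  qed
  with G H show thesis using that order_trans by blast
qed

lemma norm_functional_almost_attained:
  fixes \<phi> :: "('a::real_normed_vector, 'b::real_normed_vector) proj_tensor \<Rightarrow>\<^sub>L real"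
  assumes e: "e > 0"
  obtains x y where "norm x \<le> 1" "norm y \<le> 1" "norm \<phi> - e \<le> \<phi> (ptens x y)"
proof (cases "norm \<phi> \<le> e")
  case True
  then show thesis using that[of 0 0] by (simp add: ptens.zero_left)
next
  case False
  then have "\<not> (\<forall>x y. \<phi> (ptens x y) \<le> (norm \<phi> - e) * (norm x * norm y))"
    using norm_functional_le[of "norm \<phi> - e" \<phi>] e by auto
  then obtain x y where xy: "(norm \<phi> - e) * (norm x * norm y) < \<phi> (ptens x y)" by (auto simp: not_le)
  have "x \<noteq> 0" "y \<noteq> 0" using xy by (auto simp: ptens.zero_left ptens.zero_right)
  show thesis
  proof (rule that[of "inverse (norm x) *\<^sub>R x" "inverse (norm y) *\<^sub>R y"])
    have "\<phi> (ptens (inverse (norm x) *\<^sub>R x) (inverse (norm y) *\<^sub>R y)) = \<phi> (ptens x y) / (norm x * norm y)"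
      by (simp add: ptens.scaleR_left ptens.scaleR_right blinfun.scaleR_right divide_simps)
    then show "norm \<phi> - e \<le> \<phi> (ptens (inverse (norm x) *\<^sub>R x) (inverse (norm y) *\<^sub>R y))"
      using xy \<open>x \<noteq> 0\<close> \<open>y \<noteq> 0\<close> by (simp add: pos_le_divide_eq)
  qed (use \<open>x \<noteq> 0\<close> \<open>y \<noteq> 0\<close> in auto)
qed

theorem reflexive_proj_tensor:
  assumes refl: "reflexive_space TYPE('a::real_normed_vector)" "reflexive_space TYPE('b::real_normed_vector)"
    and dense: "\<And>\<phi> :: ('a, 'b) proj_tensor \<Rightarrow>\<^sub>L real. \<phi> \<in> closure (span rank_one_functionals)"
  shows "reflexive_space TYPE(('a, 'b) proj_tensor)"
proof -
  note cluster = ptens_weak_cluster[OF refl dense]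
  \<comment> \<open>Norms are attained at elementary tensors: a weak cluster point of a maximising
    sequence of elementary tensors is again elementary.\<close>
  have "\<exists>x y. norm x \<le> 1 \<and> norm y \<le> 1 \<and> \<phi> (ptens x y) = norm \<phi>"
    for \<phi> :: "('a, 'b) proj_tensor \<Rightarrow>\<^sub>L real"
  proof -
    have "\<exists>x y. norm x \<le> 1 \<and> norm y \<le> 1 \<and> norm \<phi> - 1 / real (Suc n) \<le> \<phi> (ptens x y)" for n
      by (rule norm_functional_almost_attained[of "1 / real (Suc n)" \<phi>]) auto
    then obtain xs ys where s: "\<And>n. norm (xs n) \<le> 1" "\<And>n. norm (ys n) \<le> 1"
        "\<And>n. norm \<phi> - 1 / real (Suc n) \<le> \<phi> (ptens (xs n) (ys n))" by metis
    obtain G x y where G: "G \<noteq> bot" "G \<le> sequentially" "norm x \<le> 1" "norm y \<le> 1"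
      "((\<lambda>i. \<phi> (ptens (xs i) (ys i))) \<longlongrightarrow> \<phi> (ptens x y)) G"
      using cluster[where xs=xs and ys=ys, OF sequentially_bot s(1,2)] by metis
    have "(\<lambda>n. norm \<phi> - 1 / real (Suc n)) \<longlonglongrightarrow> norm \<phi> - 0"
      by (intro tendsto_intros LIMSEQ_Suc lim_1_over_n)
    then have "norm \<phi> - 0 \<le> \<phi> (ptens x y)"
      using s(3) by (intro tendsto_le[OF G(1) G(5) tendsto_mono[OF G(2)]]) auto
    moreover have "\<phi> (ptens x y) \<le> norm \<phi> * norm (ptens x y)"
      using norm_blinfun[of \<phi> "ptens x y"] by simp
    moreover have "norm \<phi> * norm (ptens x y) \<le> norm \<phi>"
      using norm_ptens_le_1[OF G(3,4)] by (intro mult_left_le) auto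
    ultimately show ?thesis using G(3,4) by force
  qed
  then obtain X Y where XY: "\<And>\<phi>. norm (X \<phi>) \<le> 1" "\<And>\<phi>. norm (Y \<phi>) \<le> 1"
      "\<And>\<phi> :: ('a, 'b) proj_tensor \<Rightarrow>\<^sub>L real. blinfun_apply \<phi> (ptens (X \<phi>) (Y \<phi>)) = norm \<phi>" by metis
  define k where "k \<phi> = ptens (X \<phi>) (Y \<phi>)" for \<phi>
  note emb = bounded_linear.linear[OF bounded_linear_bidual_embedding]
  have "\<Phi> \<in> closure (range bidual_embedding)" for \<Phi> :: "(('a, 'b) proj_tensor \<Rightarrow>\<^sub>L real) \<Rightarrow>\<^sub>L real"
  \<comment> \<open>Here the Banach space is the dual, and the norming elementary tensor chosen for
    \<open>\<phi>\<close> is the only prediction, so the list is constant in its index.\<close>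
  proof (rule boundary_dense[where G="\<lambda>\<phi> _. bidual_embedding (k \<phi>)"])
    show "subspace (range bidual_embedding :: ((('a, 'b) proj_tensor \<Rightarrow>\<^sub>L real) \<Rightarrow>\<^sub>L real) set)"
      by (rule linear_subspace_image[OF emb subspace_UNIV])
  next
    fix D and \<phi> :: "('a, 'b) proj_tensor \<Rightarrow>\<^sub>L real" and \<epsilon> :: real
    assume "\<phi> \<in> closure D" and \<epsilon>: "\<epsilon> > 0"
    then obtain d where d: "\<And>n. d n \<in> D" "d \<longlonglongrightarrow> \<phi>" unfolding closure_sequential by blast
    obtain G x y where G: "G \<noteq> bot" "G \<le> sequentially" "norm x \<le> 1" "norm y \<le> 1"
      "\<And>\<psi> :: ('a, 'b) proj_tensor \<Rightarrow>\<^sub>L real. ((\<lambda>n. \<psi> (k (d n))) \<longlongrightarrow> \<psi> (ptens x y)) G"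
      by (rule cluster[where xs="\<lambda>n. X (d n)" and ys="\<lambda>n. Y (d n)", OF sequentially_bot XY(1,2)])
        (rule that, simp_all add: k_def)
    \<comment> \<open>The value is \<open>norm (d n)\<close>, attained by \<open>d n\<close> at
      \<open>k (d n)\<close>, plus the error of replacing \<open>d n\<close> by
      \<open>\<phi>\<close> on the unit ball.\<close>
    have "(\<lambda>n. \<phi> (k (d n))) \<longlonglongrightarrow> norm \<phi>"
    proof -
      have "(\<lambda>n. (\<phi> - d n) (k (d n))) \<longlonglongrightarrow> 0"
      proof (rule Lim_null_comparison)
        show "\<forall>\<^sub>F n in sequentially. norm ((\<phi> - d n) (k (d n))) \<le> norm (\<phi> - d n)"
          using norm_ptens_le_1[OF XY(1,2)]
          by (intro always_eventually allI order_trans[OF norm_blinfun] mult_left_le) (auto simp: k_def)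
        show "(\<lambda>n. norm (\<phi> - d n)) \<longlonglongrightarrow> 0"
          using tendsto_norm[OF tendsto_diff[OF tendsto_const d(2)], of \<phi>] by simp
      qed
      then have "(\<lambda>n. norm (d n) + (\<phi> - d n) (k (d n))) \<longlonglongrightarrow> norm \<phi> + 0"
        by (intro tendsto_add tendsto_norm d(2))
      then show ?thesis by (simp add: blinfun.diff_left k_def XY(3))
    qed
    then have "\<phi> (ptens x y) = norm \<phi>"
      using tendsto_unique[OF G(1) G(5)] tendsto_mono[OF G(2)] by blast
    \<comment> \<open>Mazur's theorem for subspaces: a functional vanishing on all
      \<open>k (d n)\<close> vanishes at their weak cluster point.\<close>
    moreover have "ptens x y \<in> closure (span (range (\<lambda>n. k (d n))))"
    proof (rule ccontr)
      assume "ptens x y \<notin> closure (span (range (\<lambda>n. k (d n))))"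
      then obtain \<psi> :: "('a, 'b) proj_tensor \<Rightarrow>\<^sub>L real"
        where \<psi>: "\<And>s. s \<in> span (range (\<lambda>n. k (d n))) \<Longrightarrow> \<psi> s = 0" "\<psi> (ptens x y) \<noteq> 0"
        using annihilating_functional[OF subspace_span] by blast
      have "\<psi> (k (d n)) = 0" for n by (rule \<psi>(1)) (auto intro: span_base)
      with G(5)[of \<psi>] have "((\<lambda>_. 0) \<longlongrightarrow> \<psi> (ptens x y)) G" by simp
      with \<psi>(2) show False using tendsto_unique[OF G(1) tendsto_const] by metis
    qed
    then obtain v where v: "v \<in> span (range (\<lambda>n. k (d n)))" "norm (v - ptens x y) < \<epsilon>"
      using \<epsilon> unfolding closure_approachable dist_norm by blast
    have "bidual_embedding v \<in> span (bidual_embedding ` range (\<lambda>n. k (d n)))"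
      unfolding linear_span_image[OF emb] using v(1) by (rule imageI)
    then have "bidual_embedding v \<in> span (\<Union>\<psi>\<in>D. range (\<lambda>_::nat. bidual_embedding (k \<psi>)))"
      by (rule subsetD[OF span_mono, rotated]) (use d(1) in auto)
    moreover have "norm (bidual_embedding (ptens x y) - bidual_embedding v) \<le> \<epsilon>"
      using v(2) by (simp add: norm_bidual_embedding norm_minus_commute flip: linear_diff[OF emb])
    ultimately show "\<exists>b. norm b \<le> 1 \<and> blinfun_apply b \<phi> = norm \<phi> \<and>
        (\<exists>c\<in>span (\<Union>\<psi>\<in>D. range (\<lambda>_. bidual_embedding (k \<psi>))). norm (b - c) \<le> \<epsilon>)"
      using norm_ptens_le_1[OF G(3,4)]
      by (intro exI[of _ "bidual_embedding (ptens x y)"])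
         (auto simp: norm_bidual_embedding bidual_embedding.rep_eq)
  qed auto
  \<comment> \<open>The range is an isometric image of a complete space, so its density makes it the
    whole bidual.\<close>
  moreover have "closed (range (bidual_embedding :: ('a, 'b) proj_tensor \<Rightarrow> _))"
    by (intro complete_imp_closed complete_isometric_image[of 1] subspace_UNIV bounded_linear_bidual_embedding)
       (simp_all add: norm_bidual_embedding complete_UNIV)
  ultimately show ?thesis unfolding reflexive_space_def by auto
qed

theorem theorem2p1:
  assumes "metric_approximation_property TYPE('a::banach) \<or>
           metric_approximation_property TYPE('b::banach)"
    and "strongly_subdifferentiable TYPE(('a, 'b) proj_tensor)"
  shows "(\<forall>T :: 'a \<Rightarrow>\<^sub>L ('b \<Rightarrow>\<^sub>L real). compact_operator T) \<and>
         (reflexive_space TYPE('a) \<and> reflexive_space TYPE('b) \<longrightarrow>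
          reflexive_space TYPE(('a, 'b) proj_tensor))"
proof -
  have "\<phi> \<in> closure (span rank_one_functionals)" for \<phi> :: "('a, 'b) proj_tensor \<Rightarrow>\<^sub>L real"
    by (rule ssd_norming_dense[OF assms(2) subspace_span rank_one_norming[OF assms(1)]])
  then show ?thesis using compact_operator_if_dense reflexive_proj_tensor by blast
qed

end
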